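(* Let $W$ be a standard one-dimensional Brownian motion, $T>0$, and let $f:\mathbb{R}\to\mathbb{R}$ be bounded with ${\rm osc}_f(\delta)\le C\delta^\alpha$ for some $\alpha\in(0,1]$, $C>0$ and all sufficiently small $\delta>0$. For $\varepsilon>0$ let $Q_\varepsilon(t)=[f(\varepsilon W),\varepsilon W](t)$. Let $(n_\varepsilon)_{\varepsilon>0}$ be positive integers with $n_\varepsilon\nearrow\infty$ as $\varepsilon\to0$, let $\delta_\varepsilon=T/n_\varepsilon$ and $q_\varepsilon=2\sqrt{\delta_\varepsilon|\log\delta_\varepsilon|}$, and let $(\gamma_\varepsilon)_{\varepsilon>0}$ satisfy $\gamma_\varepsilon\to0$ and \[ |\log\delta_\varepsilon|\,\frac{{\rm osc}_f(\varepsilon q_\varepsilon)}{q_\varepsilon\gamma_\varepsilon}\to0,\qquad\varepsilon\to0. \] Then there are positive constants $K_1,K_2,K_3,\varepsilon_0$ such that \[ \mathsf{P}\Big\{\varepsilon^{-1}\sup_{t\le T}|Q_\varepsilon(t)|>\gamma_\varepsilon\Big\}\le K_1\gamma_\varepsilon^{-1}e^{-K_3\gamma_\varepsilon^2/{\rm osc}_f(\varepsilon q_\varepsilon)^2}+K_2\delta_\varepsilon,\qquad\varepsilon\in(0,\varepsilon_0). \]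
   Context: ${\rm osc}_f(\delta)=\sup_{|t-s|<\delta}|f(s)-f(t)|$. The quadratic covariation $[X,Y](t)$ is the limit in probability, as the mesh of partitions of $[0,t]$ tends to $0$, of sums of products of increments of $X$ and $Y$. *)

theory Defs
  imports "HOL-Probability.Probability"
begin

definition osc :: "(real \<Rightarrow> real) \<Rightarrow> real \<Rightarrow> real" where
  "osc f \<delta> = (SUP p \<in> {(s, t). \<bar>t - s\<bar> < \<delta>}. \<bar>f (fst p) - f (snd p)\<bar>)"

definition brownian_motion :: "'a measure \<Rightarrow> (real \<Rightarrow> 'a \<Rightarrow> real) \<Rightarrow> bool" where
  "brownian_motion M W \<longleftrightarrow>
     prob_space M \<and>
     (\<forall>t\<ge>0. W t \<in> borel_measurable M) \<and>
     (\<forall>\<omega>\<in>space M. W 0 \<omega> = 0) \<and>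
     (\<forall>\<omega>\<in>space M. continuous_on {0..} (\<lambda>t. W t \<omega>)) \<and>
     (\<forall>(m::nat) (t::nat \<Rightarrow> real). 0 \<le> t 0 \<longrightarrow> (\<forall>i<m. t i \<le> t (Suc i)) \<longrightarrow>
        prob_space.indep_vars M (\<lambda>_. borel) (\<lambda>i \<omega>. W (t (Suc i)) \<omega> - W (t i) \<omega>) {..<m}) \<and>
     (\<forall>s t. 0 \<le> s \<longrightarrow> s < t \<longrightarrow>
        distributed M lborel (\<lambda>\<omega>. W t \<omega> - W s \<omega>) (normal_density 0 (sqrt (t - s))))"

definition partition_of :: "(nat \<Rightarrow> real) \<Rightarrow> nat \<Rightarrow> real \<Rightarrow> bool" where
  "partition_of p m t \<longleftrightarrow> p 0 = 0 \<and> p m = t \<and> (\<forall>i<m. p i < p (Suc i))"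

definition cov_sum :: "(real \<Rightarrow> 'a \<Rightarrow> real) \<Rightarrow> (real \<Rightarrow> 'a \<Rightarrow> real) \<Rightarrow> (nat \<Rightarrow> real) \<Rightarrow> nat \<Rightarrow> 'a \<Rightarrow> real" where
  "cov_sum X Y p m \<omega> = (\<Sum>i<m. (X (p (Suc i)) \<omega> - X (p i) \<omega>) * (Y (p (Suc i)) \<omega> - Y (p i) \<omega>))"

definition is_qcov :: "'a measure \<Rightarrow> (real \<Rightarrow> 'a \<Rightarrow> real) \<Rightarrow> (real \<Rightarrow> 'a \<Rightarrow> real) \<Rightarrow> real \<Rightarrow> ('a \<Rightarrow> real) \<Rightarrow> bool" where
  "is_qcov M X Y t c \<longleftrightarrow> c \<in> borel_measurable M \<and>
     (\<forall>e>0. \<forall>\<eta>>0. \<exists>d>0. \<forall>m p. partition_of p m t \<and> (\<forall>i<m. p (Suc i) - p i < d) \<longrightarrow>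
        measure M {\<omega> \<in> space M. \<bar>cov_sum X Y p m \<omega> - c \<omega>\<bar> > e} < \<eta>)"

text \<open>exp(-K g^2 / o^2), with the natural convention exp(-infinity) = 0 when o = 0.\<close>
definition gauss_tail :: "real \<Rightarrow> real \<Rightarrow> real \<Rightarrow> real" where
  "gauss_tail K g w = (if w = 0 then 0 else exp (- K * g\<^sup>2 / w\<^sup>2))"

end

theory Submission
  imports Defs "HOL-Real_Asymp.Real_Asymp"
begin

text \<open>
  Cut \<open>[0, T]\<close> into \<open>n\<close> blocks of length \<open>\<delta>\<close>. Outside an event of probability \<open>O(\<delta>)\<close> the Brownian
  path stays within \<open>q\<close> of its value at the left end of each block, and then \<open>f(\<epsilon>W)\<close> may be replaced on
  each block by its increment since that left end, clipped at height \<open>w = osc f (\<epsilon> q)\<close>; clipping makes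
  the integrands bounded on the whole probability space, so that no localization is needed.
  On a fine grid the clipped covariation sum of a block is a backward sum minus a forward sum. The
  forward sum is a martingale. Writing an increment of a Gaussian walk as a multiple of the walk's next
  value plus an independent Gaussian turns the backward sum into a reversed martingale plus a drift
  bounded by \<open>w \<Sum> \<bar>U\<^sub>i\<bar> / i\<close>. All three are sub-Gaussian with variance of order \<open>w\<^sup>2 r\<close> over an
  interval of length \<open>r\<close>, uniformly in the grid. The hypothesis on \<open>\<gamma>\<close> forces \<open>n = o(\<gamma>\<^sup>2 / w\<^sup>2)\<close>,
  which absorbs both the factor \<open>2\<^sup>n\<close> collected over the blocks and a union bound over their
  endpoints. Inside the blocks the supremum is controlled by dyadic chaining.
\<close>

subsection \<open>Centred Gaussian measures\<close>

definition gauss :: "real \<Rightarrow> real measure" where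
  "gauss v = density lborel (\<lambda>x. ennreal (normal_density 0 (sqrt v) x))"

lemma sets_gauss [simp, measurable_cong]: "sets (gauss v) = sets borel"
  by (simp add: gauss_def)

lemma space_gauss [simp]: "space (gauss v) = UNIV"
  by (simp add: gauss_def)

lemma prob_space_gauss: "v > 0 \<Longrightarrow> prob_space (gauss v)"
  unfolding gauss_def by (rule prob_space_normal_density) simp

lemma nn_integral_gauss:
  "F \<in> borel_measurable borel \<Longrightarrow>
    (\<integral>\<^sup>+x. F x \<partial>gauss v) = (\<integral>\<^sup>+x. ennreal (normal_density 0 (sqrt v) x) * F x \<partial>lborel)"
  unfolding gauss_def by (subst nn_integral_density) simp_all

lemma nn_integral_gauss_exp:
  assumes "v > 0"
  shows "(\<integral>\<^sup>+x. ennreal (exp (a * x)) \<partial>gauss v) = ennreal (exp (a\<^sup>2 * v / 2))"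
proof -
  have complete_square: "normal_density 0 (sqrt v) x * exp (a * x) =
      exp (a\<^sup>2 * v / 2) * normal_density (a * v) (sqrt v) x" for x
  proof -
    have "- x\<^sup>2 / (2 * v) + a * x = a\<^sup>2 * v / 2 + (- (x - a * v)\<^sup>2 / (2 * v))"
      using assms by (simp add: field_simps power2_eq_square)
    then show ?thesis
      using assms by (simp add: normal_density_def mult_exp_exp)
  qed
  have "(\<integral>\<^sup>+x. ennreal (exp (a * x)) \<partial>gauss v)
      = (\<integral>\<^sup>+x. ennreal (exp (a\<^sup>2 * v / 2)) * ennreal (normal_density (a * v) (sqrt v) x) \<partial>lborel)"
    by (subst nn_integral_gauss)
       (auto intro!: nn_integral_cong simp: ennreal_mult[symmetric] complete_square)
  also have "\<dots> = ennreal (exp (a\<^sup>2 * v / 2))"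
    using assms by (simp add: nn_integral_cmult nn_integral_eq_integral)
  finally show ?thesis .
qed

lemma normal_density_rotate:
  assumes "s > 0" "t > 0"
  shows "normal_density 0 (sqrt t) (z + t / (s + t) * w) *
      normal_density 0 (sqrt s) (w - (z + t / (s + t) * w))
    = normal_density 0 (sqrt (s + t)) w * normal_density 0 (sqrt (s * t / (s + t))) z"
proof -
  define k where "k = s + t"
  have k_props: "k > 0" "s = k - t" using assms by (auto simp: k_def)
  have exponents: "- (z + t / k * w)\<^sup>2 / (2 * t) + - (w - (z + t / k * w))\<^sup>2 / (2 * s)
      = - w\<^sup>2 / (2 * k) + - z\<^sup>2 / (2 * (s * t / k))"
    using assms k_props(1)
    by (simp add: divide_simps) (simp add: k_props(2) algebra_simps power2_eq_square)
  have constants: "1 / sqrt (2 * pi * t) * (1 / sqrt (2 * pi * s))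
      = 1 / sqrt (2 * pi * k) * (1 / sqrt (2 * pi * (s * t / k)))"
    using assms k_props(1) by (simp add: real_sqrt_mult[symmetric])
  have "1 / sqrt (2 * pi * t) * exp (- (z + t / k * w)\<^sup>2 / (2 * t)) *
      (1 / sqrt (2 * pi * s) * exp (- (w - (z + t / k * w))\<^sup>2 / (2 * s)))
    = (1 / sqrt (2 * pi * t) * (1 / sqrt (2 * pi * s))) *
      exp (- (z + t / k * w)\<^sup>2 / (2 * t) + - (w - (z + t / k * w))\<^sup>2 / (2 * s))"
    unfolding exp_add by (simp only: mult_ac)
  also have "\<dots> = 1 / sqrt (2 * pi * k) * exp (- w\<^sup>2 / (2 * k)) *
      (1 / sqrt (2 * pi * (s * t / k)) * exp (- z\<^sup>2 / (2 * (s * t / k))))"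
    unfolding exponents constants exp_add by (simp only: mult_ac)
  finally show ?thesis
    using assms k_props(1) by (simp add: normal_density_def k_def[symmetric])
qed

text \<open>For independent \<open>u \<sim> N(0, s)\<close> and \<open>y \<sim> N(0, t)\<close>, the sum \<open>w = u + y\<close> and the residual
  \<open>z = y - t w / (s + t)\<close> are uncorrelated, hence independent Gaussians.\<close>

lemma nn_integral_gauss_rotate:
  fixes F :: "real \<Rightarrow> real \<Rightarrow> ennreal"
  assumes st_pos: "s > 0" "t > 0"
    and [measurable]: "case_prod F \<in> borel_measurable (borel \<Otimes>\<^sub>M borel)"
  shows "(\<integral>\<^sup>+y. \<integral>\<^sup>+u. F (u + y) (y - t / (s + t) * (u + y)) \<partial>gauss s \<partial>gauss t)
    = (\<integral>\<^sup>+w. \<integral>\<^sup>+z. F w z \<partial>gauss (s * t / (s + t)) \<partial>gauss (s + t))"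
proof -
  let ?p = "\<lambda>v x. ennreal (normal_density 0 (sqrt v) x)" and ?c = "t / (s + t)"
  define G where "G y w = ?p t y * (?p s (w - y) * F w (y - ?c * w))" for y w
  have [measurable]: "case_prod G \<in> borel_measurable (borel \<Otimes>\<^sub>M borel)"
    unfolding G_def by measurable
  have "(\<integral>\<^sup>+y. \<integral>\<^sup>+u. F (u + y) (y - ?c * (u + y)) \<partial>gauss s \<partial>gauss t)
      = (\<integral>\<^sup>+y. \<integral>\<^sup>+u. ?p t y * (?p s u * F (u + y) (y - ?c * (u + y))) \<partial>lborel \<partial>lborel)"
    by (simp add: nn_integral_gauss nn_integral_cmult)
  also have "\<dots> = (\<integral>\<^sup>+y. \<integral>\<^sup>+w. G y w \<partial>lborel \<partial>lborel)"
  proof (rule nn_integral_cong)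
    fix y
    show "(\<integral>\<^sup>+u. ?p t y * (?p s u * F (u + y) (y - ?c * (u + y))) \<partial>lborel) = (\<integral>\<^sup>+w. G y w \<partial>lborel)"
      unfolding G_def
      by (subst (2) nn_integral_real_affine[where c = 1 and t = y]) (auto simp: add.commute)
  qed
  also have "\<dots> = (\<integral>\<^sup>+w. \<integral>\<^sup>+y. G y w \<partial>lborel \<partial>lborel)"
    by (rule lborel_pair.Fubini') measurable
  also have "\<dots> = (\<integral>\<^sup>+w. \<integral>\<^sup>+z. G (z + ?c * w) w \<partial>lborel \<partial>lborel)"
  proof (rule nn_integral_cong)
    fix w
    show "(\<integral>\<^sup>+y. G y w \<partial>lborel) = (\<integral>\<^sup>+z. G (z + ?c * w) w \<partial>lborel)"
      by (subst nn_integral_real_affine[where c = 1 and t = "?c * w"]) (auto simp: add.commute)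
  qed
  also have "\<dots> = (\<integral>\<^sup>+w. \<integral>\<^sup>+z. ?p (s + t) w * (?p (s * t / (s + t)) z * F w z) \<partial>lborel \<partial>lborel)"
    unfolding G_def
    by (simp add: mult.assoc[symmetric] ennreal_mult[symmetric] normal_density_rotate[OF st_pos]
        del: times_divide_eq_left)
  also have "\<dots> = (\<integral>\<^sup>+w. \<integral>\<^sup>+z. F w z \<partial>gauss (s * t / (s + t)) \<partial>gauss (s + t))"
    by (simp add: nn_integral_gauss nn_integral_cmult)
  finally show ?thesis .
qed

lemma nn_integral_gauss_residual_le:
  fixes \<phi> :: "real \<Rightarrow> real" and g :: "real \<Rightarrow> ennreal"
  assumes st_pos: "s > 0" "t > 0"
    and [measurable]: "\<phi> \<in> borel_measurable borel" "g \<in> borel_measurable borel"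
    and \<phi>_bound: "\<And>u. \<bar>\<phi> u\<bar> \<le> c"
  shows "(\<integral>\<^sup>+y. \<integral>\<^sup>+u. ennreal (exp (\<phi> (u + y) * (y - t / (s + t) * (u + y))))
      * g (u + y) \<partial>gauss s \<partial>gauss t)
    \<le> ennreal (exp (c\<^sup>2 * t / 2)) * (\<integral>\<^sup>+w. g w \<partial>gauss (s + t))"
proof -
  let ?v = "s * t / (s + t)"
  have v_bounds: "?v > 0" "?v \<le> t" using st_pos by (auto simp: field_simps)
  have "(\<integral>\<^sup>+y. \<integral>\<^sup>+u. ennreal (exp (\<phi> (u + y) * (y - t / (s + t) * (u + y))))
      * g (u + y) \<partial>gauss s \<partial>gauss t)
      = (\<integral>\<^sup>+w. \<integral>\<^sup>+z. ennreal (exp (\<phi> w * z)) * g w \<partial>gauss ?v \<partial>gauss (s + t))"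
    using nn_integral_gauss_rotate[OF st_pos, where F = "\<lambda>w z. ennreal (exp (\<phi> w * z)) * g w"]
    by simp
  also have "\<dots> = (\<integral>\<^sup>+w. ennreal (exp ((\<phi> w)\<^sup>2 * ?v / 2)) * g w \<partial>gauss (s + t))"
    by (simp add: nn_integral_multc nn_integral_gauss_exp[OF v_bounds(1)])
  also have "\<dots> \<le> (\<integral>\<^sup>+w. ennreal (exp (c\<^sup>2 * t / 2)) * g w \<partial>gauss (s + t))"
  proof (intro nn_integral_mono mult_right_mono ennreal_leI)
    fix w
    have "(\<phi> w)\<^sup>2 \<le> c\<^sup>2" using power_mono[OF \<phi>_bound, of w 2] by simp
    then have "(\<phi> w)\<^sup>2 * ?v \<le> c\<^sup>2 * t" using v_bounds by (intro mult_mono) auto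
    then show "exp ((\<phi> w)\<^sup>2 * ?v / 2) \<le> exp (c\<^sup>2 * t / 2)"
      by (simp only: exp_le_cancel_iff divide_right_mono zero_le_numeral)
  qed simp
  also have "\<dots> = ennreal (exp (c\<^sup>2 * t / 2)) * (\<integral>\<^sup>+w. g w \<partial>gauss (s + t))"
    by (intro nn_integral_cmult) measurable
  finally show ?thesis .
qed

subsection \<open>Sub-Gaussian random variables\<close>

text \<open>The factor \<open>B\<close> replaces the usual requirement of mean zero; taking absolute values doubles it.\<close>

definition subgaussian :: "'a measure \<Rightarrow> real \<Rightarrow> real \<Rightarrow> ('a \<Rightarrow> real) \<Rightarrow> bool" where
  "subgaussian M B v X \<longleftrightarrow> X \<in> borel_measurable M \<and>
     (\<forall>\<theta>. (\<integral>\<^sup>+x. ennreal (exp (\<theta> * X x)) \<partial>M) \<le> ennreal (B * exp (v * \<theta>\<^sup>2 / 2)))"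

lemma subgaussianI:
  "X \<in> borel_measurable M \<Longrightarrow>
    (\<And>\<theta>. (\<integral>\<^sup>+x. ennreal (exp (\<theta> * X x)) \<partial>M) \<le> ennreal (B * exp (v * \<theta>\<^sup>2 / 2))) \<Longrightarrow>
    subgaussian M B v X"
  by (simp add: subgaussian_def)

lemma subgaussian_measurable: "subgaussian M B v X \<Longrightarrow> X \<in> borel_measurable M"
  by (simp add: subgaussian_def)

lemma subgaussian_nn_integral_le:
  "subgaussian M B v X \<Longrightarrow> (\<integral>\<^sup>+x. ennreal (exp (\<theta> * X x)) \<partial>M) \<le> ennreal (B * exp (v * \<theta>\<^sup>2 / 2))"
  by (simp add: subgaussian_def)

lemma subgaussian_mono:
  assumes subgaussian_X: "subgaussian M B v X" and B_bounds: "0 \<le> B" "B \<le> B'" and v_le: "v \<le> v'"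
  shows "subgaussian M B' v' X"
proof (rule subgaussianI[OF subgaussian_measurable[OF subgaussian_X]])
  fix \<theta>
  have "v * \<theta>\<^sup>2 \<le> v' * \<theta>\<^sup>2" using v_le by (intro mult_right_mono) auto
  then have "B * exp (v * \<theta>\<^sup>2 / 2) \<le> B' * exp (v' * \<theta>\<^sup>2 / 2)"
    using B_bounds by (intro mult_mono) auto
  then show "(\<integral>\<^sup>+x. ennreal (exp (\<theta> * X x)) \<partial>M) \<le> ennreal (B' * exp (v' * \<theta>\<^sup>2 / 2))"
    by (intro order_trans[OF subgaussian_nn_integral_le[OF subgaussian_X]] ennreal_leI)
qed

lemma (in prob_space) subgaussian_zero: "subgaussian M 1 0 (\<lambda>_. 0)"
  by (intro subgaussianI) (auto simp: emeasure_space_1)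

lemma subgaussian_cmult:
  assumes "subgaussian M B v X"
  shows "subgaussian M B (a\<^sup>2 * v) (\<lambda>x. a * X x)"
proof (rule subgaussianI)
  show "(\<lambda>x. a * X x) \<in> borel_measurable M" using subgaussian_measurable[OF assms] by measurable
  show "(\<integral>\<^sup>+x. ennreal (exp (\<theta> * (a * X x))) \<partial>M) \<le> ennreal (B * exp (a\<^sup>2 * v * \<theta>\<^sup>2 / 2))" for \<theta>
    using subgaussian_nn_integral_le[OF assms, of "\<theta> * a"] by (simp add: power_mult_distrib mult_ac)
qed

lemma subgaussian_uminus: "subgaussian M B v X \<Longrightarrow> subgaussian M B v (\<lambda>x. - X x)"
  using subgaussian_cmult[of M B v X "- 1"] by simp

lemma subgaussian_abs:
  assumes subgaussian_X: "subgaussian M B v X" and B_nonneg: "0 \<le> B"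
  shows "subgaussian M (2 * B) v (\<lambda>x. \<bar>X x\<bar>)"
proof (rule subgaussianI)
  note [measurable] = subgaussian_measurable[OF subgaussian_X]
  show "(\<lambda>x. \<bar>X x\<bar>) \<in> borel_measurable M" by measurable
  fix \<theta>
  have "exp (\<theta> * \<bar>X x\<bar>) \<le> exp (\<theta> * X x) + exp (- \<theta> * X x)" for x
    using exp_ge_zero[of "\<theta> * X x"] exp_ge_zero[of "- \<theta> * X x"] by (auto simp: abs_if)
  then have "(\<integral>\<^sup>+x. ennreal (exp (\<theta> * \<bar>X x\<bar>)) \<partial>M)
      \<le> (\<integral>\<^sup>+x. ennreal (exp (\<theta> * X x)) + ennreal (exp (- \<theta> * X x)) \<partial>M)"
    by (intro nn_integral_mono) (simp add: ennreal_plus[symmetric] ennreal_leI del: ennreal_plus)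
  also have "\<dots> = (\<integral>\<^sup>+x. ennreal (exp (\<theta> * X x)) \<partial>M) + (\<integral>\<^sup>+x. ennreal (exp (- \<theta> * X x)) \<partial>M)"
    by (intro nn_integral_add) measurable
  also have "\<dots> \<le> ennreal (B * exp (v * \<theta>\<^sup>2 / 2)) + ennreal (B * exp (v * (- \<theta>)\<^sup>2 / 2))"
    by (intro add_mono subgaussian_nn_integral_le[OF subgaussian_X])
  also have "\<dots> = ennreal (2 * B * exp (v * \<theta>\<^sup>2 / 2))"
    using B_nonneg by (simp add: ennreal_plus[symmetric] del: ennreal_plus)
  finally show "(\<integral>\<^sup>+x. ennreal (exp (\<theta> * \<bar>X x\<bar>)) \<partial>M) \<le> ennreal (2 * B * exp (v * \<theta>\<^sup>2 / 2))" .
qed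

lemma subgaussian_dominated:
  assumes subgaussian_X: "subgaussian M B v X" and Y_measurable: "Y \<in> borel_measurable M"
    and abs_Y_le: "\<And>x. x \<in> space M \<Longrightarrow> \<bar>Y x\<bar> \<le> X x"
  shows "subgaussian M B v Y"
proof (rule subgaussianI[OF Y_measurable])
  fix \<theta>
  have "\<theta> * Y x \<le> \<bar>\<theta>\<bar> * X x" if "x \<in> space M" for x
    using mult_left_mono[OF abs_Y_le[OF that], of "\<bar>\<theta>\<bar>"] abs_ge_self[of "\<theta> * Y x"]
    by (simp add: abs_mult)
  then have "(\<integral>\<^sup>+x. ennreal (exp (\<theta> * Y x)) \<partial>M) \<le> (\<integral>\<^sup>+x. ennreal (exp (\<bar>\<theta>\<bar> * X x)) \<partial>M)"
    by (intro nn_integral_mono ennreal_leI) simp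
  then show "(\<integral>\<^sup>+x. ennreal (exp (\<theta> * Y x)) \<partial>M) \<le> ennreal (B * exp (v * \<theta>\<^sup>2 / 2))"
    using subgaussian_nn_integral_le[OF subgaussian_X, of "\<bar>\<theta>\<bar>"] by simp
qed

text \<open>No independence is assumed: the standard deviations \<open>\<sigma>\<close>, \<open>\<tau>\<close> add up, not their squares.\<close>

lemma subgaussian_add:
  assumes subgaussian_X: "subgaussian M B (\<sigma>\<^sup>2) X" and subgaussian_Y: "subgaussian M B (\<tau>\<^sup>2) Y"
    and B_nonneg: "0 \<le> B" and \<sigma>\<tau>_pos: "\<sigma> > 0" "\<tau> > 0"
  shows "subgaussian M B ((\<sigma> + \<tau>)\<^sup>2) (\<lambda>x. X x + Y x)"
proof (rule subgaussianI)
  note [measurable] =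
    subgaussian_measurable[OF subgaussian_X] subgaussian_measurable[OF subgaussian_Y]
  show "(\<lambda>x. X x + Y x) \<in> borel_measurable M" by measurable
  fix \<theta>
  define s p r where "s = \<sigma> + \<tau>" and "p = \<sigma> / s" and "r = \<tau> / s"
  have s_pos: "s > 0" and weights: "p > 0" "r > 0" "p + r = 1"
    using \<sigma>\<tau>_pos by (auto simp: s_def p_def r_def add_divide_distrib[symmetric])
  have convex: "exp (\<theta> * (X x + Y x)) \<le> p * exp (\<theta> / p * X x) + r * exp (\<theta> / r * Y x)" for x
  proof -
    have p_eq: "1 - r = p" using weights(3) by simp
    have "exp (p * (\<theta> / p * X x) + r * (\<theta> / r * Y x))
        \<le> p * exp (\<theta> / p * X x) + r * exp (\<theta> / r * Y x)"
      using convex_onD[OF exp_convex, of r "\<theta> / p * X x" "\<theta> / r * Y x"] weights unfolding p_eq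
      by simp
    then show ?thesis using weights by (simp add: distrib_left)
  qed
  have scale: "\<sigma>\<^sup>2 * (\<theta> / p)\<^sup>2 = s\<^sup>2 * \<theta>\<^sup>2" "\<tau>\<^sup>2 * (\<theta> / r)\<^sup>2 = s\<^sup>2 * \<theta>\<^sup>2"
    using \<sigma>\<tau>_pos s_pos by (simp_all add: p_def r_def power_divide power_mult_distrib)
  let ?E = "ennreal (B * exp (s\<^sup>2 * \<theta>\<^sup>2 / 2))"
  have "(\<integral>\<^sup>+x. ennreal (exp (\<theta> * (X x + Y x))) \<partial>M)
      \<le> (\<integral>\<^sup>+x. ennreal p * ennreal (exp (\<theta> / p * X x)) +
          ennreal r * ennreal (exp (\<theta> / r * Y x)) \<partial>M)"
    using weights by (intro nn_integral_mono order_trans[OF ennreal_leI[OF convex]])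
      (simp add: ennreal_mult[symmetric] ennreal_plus[symmetric] del: ennreal_plus)
  also have "\<dots> = ennreal p * (\<integral>\<^sup>+x. ennreal (exp (\<theta> / p * X x)) \<partial>M) +
      ennreal r * (\<integral>\<^sup>+x. ennreal (exp (\<theta> / r * Y x)) \<partial>M)"
    by (simp add: nn_integral_add nn_integral_cmult)
  also have "\<dots> \<le> ennreal p * ?E + ennreal r * ?E"
    using subgaussian_nn_integral_le[OF subgaussian_X, of "\<theta> / p"]
      subgaussian_nn_integral_le[OF subgaussian_Y, of "\<theta> / r"]
    unfolding scale by (intro add_mono mult_left_mono) simp_all
  also have "\<dots> = ?E"
    using weights by (simp add: distrib_right[symmetric] ennreal_plus[symmetric] del: ennreal_plus)
  finally show "(\<integral>\<^sup>+x. ennreal (exp (\<theta> * (X x + Y x))) \<partial>M)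
      \<le> ennreal (B * exp ((\<sigma> + \<tau>)\<^sup>2 * \<theta>\<^sup>2 / 2))"
    by (simp only: s_def)
qed

lemma subgaussian_sum:
  assumes "finite I" "I \<noteq> {}" and "\<And>i. i \<in> I \<Longrightarrow> subgaussian M B ((\<sigma> i)\<^sup>2) (X i)"
    and "0 \<le> B" and "\<And>i. i \<in> I \<Longrightarrow> \<sigma> i > 0"
  shows "subgaussian M B ((\<Sum>i\<in>I. \<sigma> i)\<^sup>2) (\<lambda>x. \<Sum>i\<in>I. X i x)"
  using assms
proof (induction I rule: finite_ne_induct)
  case (insert i I)
  then show ?case by (simp add: subgaussian_add sum_pos)
qed simp

lemma subgaussian_distr:
  assumes f_measurable: "f \<in> measurable M N" and subgaussian_X: "subgaussian (distr M N f) B v X"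
  shows "subgaussian M B v (\<lambda>\<omega>. X (f \<omega>))"
proof (rule subgaussianI)
  have X_measurable: "X \<in> borel_measurable N" using subgaussian_measurable[OF subgaussian_X] by simp
  with f_measurable show "(\<lambda>\<omega>. X (f \<omega>)) \<in> borel_measurable M" by measurable
  fix \<theta>
  have "(\<lambda>x. ennreal (exp (\<theta> * X x))) \<in> borel_measurable N" using X_measurable by measurable
  then show "(\<integral>\<^sup>+\<omega>. ennreal (exp (\<theta> * X (f \<omega>))) \<partial>M) \<le> ennreal (B * exp (v * \<theta>\<^sup>2 / 2))"
    using subgaussian_nn_integral_le[OF subgaussian_X, of \<theta>] f_measurable
    by (simp add: nn_integral_distr)
qed

lemma (in prob_space) subgaussian_tail:
  assumes subgaussian_X: "subgaussian M B v X" and B_nonneg: "0 \<le> B" and v_pos: "v > 0"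
    and a_pos: "a > 0"
  shows "prob {\<omega> \<in> space M. a \<le> \<bar>X \<omega>\<bar>} \<le> 2 * B * exp (- (a\<^sup>2 / (2 * v)))"
proof -
  note [measurable] = subgaussian_measurable[OF subgaussian_X]
  define \<theta> where "\<theta> = a / v"
  have \<theta>_pos: "\<theta> > 0" using a_pos v_pos by (simp add: \<theta>_def)
  have exponent: "- \<theta> * a + v * \<theta>\<^sup>2 / 2 = - (a\<^sup>2 / (2 * v))"
    using v_pos by (simp add: \<theta>_def field_simps power2_eq_square)
  have "ennreal (prob {\<omega> \<in> space M. a \<le> \<bar>X \<omega>\<bar>}) = emeasure M {\<omega> \<in> space M. a \<le> \<bar>X \<omega>\<bar>}"
    by (simp add: emeasure_eq_measure)
  also have "\<dots> \<le> ennreal (exp (- \<theta> * a)) * (\<integral>\<^sup>+\<omega>\<in>space M. ennreal (exp (\<theta> * \<bar>X \<omega>\<bar>)) \<partial>M)"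
    by (rule Chernoff_ineq_nn_integral_ge[OF \<theta>_pos]) auto
  also have "(\<integral>\<^sup>+\<omega>\<in>space M. ennreal (exp (\<theta> * \<bar>X \<omega>\<bar>)) \<partial>M) = (\<integral>\<^sup>+\<omega>. ennreal (exp (\<theta> * \<bar>X \<omega>\<bar>)) \<partial>M)"
    by (intro nn_integral_cong) simp
  also have "ennreal (exp (- \<theta> * a)) * \<dots>
      \<le> ennreal (exp (- \<theta> * a)) * ennreal (2 * B * exp (v * \<theta>\<^sup>2 / 2))"
    by (intro mult_left_mono
        subgaussian_nn_integral_le[OF subgaussian_abs[OF subgaussian_X B_nonneg]]) simp
  also have "\<dots> = ennreal (2 * B * exp (- (a\<^sup>2 / (2 * v))))"
    using B_nonneg unfolding exponent[symmetric] exp_add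
    by (simp add: ennreal_mult[symmetric] mult_ac)
  finally show ?thesis using B_nonneg by simp
qed

subsection \<open>Past and future of an i.i.d. sequence\<close>

lemma (in sequence_space) nn_integral_comb_seq:
  assumes [measurable]: "F \<in> borel_measurable S"
  shows "(\<integral>\<^sup>+x. F x \<partial>S) = (\<integral>\<^sup>+x. \<integral>\<^sup>+y. F (comb_seq n x y) \<partial>S \<partial>S)"
    and "(\<integral>\<^sup>+x. F x \<partial>S) = (\<integral>\<^sup>+y. \<integral>\<^sup>+x. F (comb_seq n x y) \<partial>S \<partial>S)"
proof -
  interpret SS: pair_sigma_finite S S ..
  have "(\<integral>\<^sup>+x. F x \<partial>S) = (\<integral>\<^sup>+x. F x \<partial>distr (S \<Otimes>\<^sub>M S) S (\<lambda>(x, y). comb_seq n x y))"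
    by (simp only: PiM_comb_seq)
  also have "\<dots> = (\<integral>\<^sup>+p. F (case_prod (comb_seq n) p) \<partial>(S \<Otimes>\<^sub>M S))"
    by (intro nn_integral_distr measurable_comb_seq) simp
  finally show past_first: "(\<integral>\<^sup>+x. F x \<partial>S) = (\<integral>\<^sup>+x. \<integral>\<^sup>+y. F (comb_seq n x y) \<partial>S \<partial>S)"
    by (simp add: P.nn_integral_fst[symmetric])
  show "(\<integral>\<^sup>+x. F x \<partial>S) = (\<integral>\<^sup>+y. \<integral>\<^sup>+x. F (comb_seq n x y) \<partial>S \<partial>S)"
    unfolding past_first by (rule SS.Fubini') measurable
qed

lemma (in sequence_space) nn_integral_component:
  assumes "g \<in> borel_measurable M"
  shows "(\<integral>\<^sup>+x. g (x i) \<partial>S) = (\<integral>\<^sup>+u. g u \<partial>M)"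
  by (subst PiM_component[of i, symmetric]) (simp_all add: nn_integral_distr assms)

definition depends_below :: "nat \<Rightarrow> ((nat \<Rightarrow> 'a) \<Rightarrow> 'b) \<Rightarrow> bool" where
  "depends_below n F \<longleftrightarrow> (\<forall>x y. (\<forall>i<n. x i = y i) \<longrightarrow> F x = F y)"

lemma depends_below_comb_seq: "depends_below n F \<Longrightarrow> F (comb_seq n x y) = F x"
  by (auto simp: depends_below_def comb_seq_less)

lemma depends_below_mono: "depends_below m F \<Longrightarrow> m \<le> n \<Longrightarrow> depends_below n F"
  unfolding depends_below_def by (meson less_le_trans)

lemma depends_below_component: "i < n \<Longrightarrow> depends_below n (\<lambda>x. x i)"
  by (auto simp: depends_below_def)

lemma depends_below_compose2:
  "depends_below n F \<Longrightarrow> depends_below n G \<Longrightarrow> depends_below n (\<lambda>x. h (F x) (G x))"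
  unfolding depends_below_def by metis

lemma depends_below_sum:
  "(\<And>i. i \<in> I \<Longrightarrow> depends_below n (F i)) \<Longrightarrow> depends_below n (\<lambda>x. \<Sum>i\<in>I. F i x)"
  unfolding depends_below_def by (metis sum.cong)

lemma (in sequence_space) subgaussian_add_future:
  assumes past: "subgaussian S B v A" "depends_below n A" and B_nonneg: "0 \<le> B"
    and X_measurable: "X \<in> borel_measurable S"
    and future: "\<And>x. x \<in> space S \<Longrightarrow> subgaussian S B' v' (\<lambda>y. X (comb_seq n x y))"
  shows "subgaussian S (B * B') (v + v') (\<lambda>x. A x + X x)"
proof (rule subgaussianI)
  note [measurable] = subgaussian_measurable[OF past(1)] X_measurable
  show "(\<lambda>x. A x + X x) \<in> borel_measurable S" by measurable
  fix \<theta>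
  let ?E = "ennreal (B' * exp (v' * \<theta>\<^sup>2 / 2))"
  have "(\<integral>\<^sup>+x. ennreal (exp (\<theta> * (A x + X x))) \<partial>S)
      = (\<integral>\<^sup>+x. \<integral>\<^sup>+y. ennreal (exp (\<theta> * A x)) * ennreal (exp (\<theta> * X (comb_seq n x y))) \<partial>S \<partial>S)"
    by (subst nn_integral_comb_seq(1)[of _ n])
       (simp_all add: depends_below_comb_seq[OF past(2)] distrib_left exp_add ennreal_mult)
  also have "\<dots> = (\<integral>\<^sup>+x. ennreal (exp (\<theta> * A x))
      * (\<integral>\<^sup>+y. ennreal (exp (\<theta> * X (comb_seq n x y))) \<partial>S) \<partial>S)"
    by (intro nn_integral_cong nn_integral_cmult) measurable
  also have "\<dots> \<le> (\<integral>\<^sup>+x. ennreal (exp (\<theta> * A x)) * ?E \<partial>S)"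
    by (intro nn_integral_mono mult_left_mono subgaussian_nn_integral_le[OF future]) auto
  also have "\<dots> = (\<integral>\<^sup>+x. ennreal (exp (\<theta> * A x)) \<partial>S) * ?E"
    by (intro nn_integral_multc) measurable
  also have "\<dots> \<le> ennreal (B * exp (v * \<theta>\<^sup>2 / 2)) * ?E"
    by (intro mult_right_mono subgaussian_nn_integral_le[OF past(1)]) simp
  also have "\<dots> = ennreal (B * B' * exp ((v + v') * \<theta>\<^sup>2 / 2))"
    using B_nonneg
    by (simp add: ennreal_mult'[symmetric] add_divide_distrib distrib_right exp_add mult_ac)
  finally show "(\<integral>\<^sup>+x. ennreal (exp (\<theta> * (A x + X x))) \<partial>S)
      \<le> ennreal (B * B' * exp ((v + v') * \<theta>\<^sup>2 / 2))" .
qed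

subsection \<open>Gaussian random walks\<close>

definition walk :: "(nat \<Rightarrow> real) \<Rightarrow> nat \<Rightarrow> real" where
  "walk x n = (\<Sum>i<n. x i)"

lemma walk_0 [simp]: "walk x 0 = 0"
  by (simp add: walk_def)

lemma walk_Suc: "walk x (Suc n) = walk x n + x n"
  by (simp add: walk_def)

lemma depends_below_walk: "m \<le> n \<Longrightarrow> depends_below n (\<lambda>x. walk x m)"
  unfolding walk_def by (intro depends_below_sum depends_below_component) simp

lemma walk_comb_seq_le: "m \<le> n \<Longrightarrow> walk (comb_seq n x y) m = walk x m"
  by (rule depends_below_comb_seq[OF depends_below_walk])

lemma walk_comb_seq_add: "walk (comb_seq n x y) (n + m) = walk x n + walk y m"
  by (induction m)
     (simp_all add: walk_comb_seq_le walk_Suc comb_seq_add[of n x y, unfolded add.commute[of _ n]])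

lemma walk_comb_seq_Suc: "walk (comb_seq n x y) (Suc n) = walk x n + y 0"
  using walk_comb_seq_add[of n x y "Suc 0"] by (simp add: walk_Suc)

text \<open>The reversed walk drifts from \<open>walk x (Suc i)\<close> towards \<open>0\<close> by the fraction \<open>1 / (i + 1)\<close>; what
  remains of its step after this drift is independent of the walk at the later times.\<close>

definition reversed_step :: "nat \<Rightarrow> (nat \<Rightarrow> real) \<Rightarrow> real" where
  "reversed_step i x = x i - walk x (Suc i) / real (Suc i)"

lemma reversed_step_comb_seq:
  "reversed_step n (comb_seq n x y) = y 0 - (walk x n + y 0) / real (Suc n)"
  using comb_seq_add[of n x y 0] by (simp add: reversed_step_def walk_comb_seq_Suc)

definition reversed_sum :: "(real \<Rightarrow> real) \<Rightarrow> nat \<Rightarrow> (nat \<Rightarrow> real) \<Rightarrow> real" where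
  "reversed_sum \<phi> n x = (\<Sum>i<n. \<phi> (walk x (Suc i)) * reversed_step i x)"

lemma depends_below_reversed_sum: "depends_below n (reversed_sum \<phi> n)"
  unfolding reversed_sum_def
proof (intro depends_below_sum)
  fix i assume "i \<in> {..<n}"
  then have "depends_below n (\<lambda>x. walk x (Suc i))" "depends_below n (\<lambda>x. x i)"
    by (auto intro!: depends_below_walk depends_below_component)
  then show "depends_below n (\<lambda>x. \<phi> (walk x (Suc i)) * reversed_step i x)"
    unfolding reversed_step_def by (rule depends_below_compose2)
qed

lemma reversed_sum_comb_seq_Suc:
  "reversed_sum \<phi> (Suc n) (comb_seq n x y)
    = reversed_sum \<phi> n x + \<phi> (walk x n + y 0) * (y 0 - (walk x n + y 0) / real (Suc n))"
proof -
  have "reversed_sum \<phi> (Suc n) (comb_seq n x y) = reversed_sum \<phi> n (comb_seq n x y) +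
      \<phi> (walk (comb_seq n x y) (Suc n)) * reversed_step n (comb_seq n x y)"
    by (simp add: reversed_sum_def)
  then show ?thesis
    by (simp only: depends_below_comb_seq[OF depends_below_reversed_sum] walk_comb_seq_Suc
        reversed_step_comb_seq)
qed

lemma sum_inverse_sqrt_le: "(\<Sum>i<n. 1 / sqrt (real (Suc i))) \<le> 2 * sqrt (real n)"
proof (induction n)
  case (Suc n)
  have "sqrt (real n) * sqrt (real n + 1) \<le> real n + 1 / 2"
    using arith_geo_mean_sqrt[of "real n" "real n + 1"] by (simp add: real_sqrt_mult)
  then have "2 * sqrt (real n) + 1 / sqrt (real n + 1) \<le> 2 * sqrt (real n + 1)"
    by (simp add: field_simps)
  with Suc show ?case by (simp add: add.commute)
qed simp

locale gaussian_walk =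
  fixes h :: real
  assumes h_pos: "h > 0"
begin

sublocale sequence_space "gauss h"
proof -
  interpret prob_space "gauss h" by (rule prob_space_gauss[OF h_pos])
  show "sequence_space (gauss h)" ..
qed

lemma measurable_component [measurable (raw)]: "(\<lambda>x. x i) \<in> borel_measurable S"
  using measurable_component_singleton[of i UNIV "\<lambda>_. gauss h"] by simp

lemma measurable_walk [measurable]: "(\<lambda>x. walk x n) \<in> borel_measurable S"
  unfolding walk_def by measurable

lemma subgaussian_component: "subgaussian S 1 h (\<lambda>x. x i)"
proof (rule subgaussianI)
  fix \<theta>
  have "(\<integral>\<^sup>+x. ennreal (exp (\<theta> * x i)) \<partial>S) = (\<integral>\<^sup>+u. ennreal (exp (\<theta> * u)) \<partial>gauss h)"
    by (rule nn_integral_component[where g = "\<lambda>u. ennreal (exp (\<theta> * u))"]) measurable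
  then show "(\<integral>\<^sup>+x. ennreal (exp (\<theta> * x i)) \<partial>S) \<le> ennreal (1 * exp (h * \<theta>\<^sup>2 / 2))"
    unfolding nn_integral_gauss_exp[OF h_pos] by (simp add: mult.commute)
qed measurable

lemma subgaussian_martingale_transform:
  assumes H_predictable: "\<And>i. H i \<in> borel_measurable S" "\<And>i. depends_below i (H i)"
    and H_bound: "\<And>i x. \<bar>H i x\<bar> \<le> c i"
  shows "subgaussian S 1 (h * (\<Sum>i<n. (c i)\<^sup>2)) (\<lambda>x. \<Sum>i<n. H i x * x i)"
proof (induction n)
  case 0
  show ?case using P.subgaussian_zero by simp
next
  case (Suc n)
  note H_predictable(1) [measurable]
  have past: "depends_below n (\<lambda>x. \<Sum>i<n. H i x * x i)"
    by (intro depends_below_sum depends_below_compose2[where h = "(*)"] depends_below_component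
        depends_below_mono[OF H_predictable(2)]) auto
  have future: "subgaussian S 1 (h * (c n)\<^sup>2) (\<lambda>y. H n (comb_seq n x y) * comb_seq n x y n)" for x
  proof -
    have "(H n x)\<^sup>2 \<le> (c n)\<^sup>2" using power_mono[OF H_bound, of n x 2] by simp
    then have "(H n x)\<^sup>2 * h \<le> h * (c n)\<^sup>2" using h_pos by (simp add: mult.commute)
    then have "subgaussian S 1 (h * (c n)\<^sup>2) (\<lambda>y. H n x * y 0)"
      by (intro subgaussian_mono[OF subgaussian_cmult[OF subgaussian_component]]) auto
    then show ?thesis
      using comb_seq_add[of n x _ 0] by (simp add: depends_below_comb_seq[OF H_predictable(2)])
  qed
  have "subgaussian S (1 * 1) (h * (\<Sum>i<n. (c i)\<^sup>2) + h * (c n)\<^sup>2)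
      (\<lambda>x. (\<Sum>i<n. H i x * x i) + H n x * x n)"
    by (intro subgaussian_add_future[OF Suc past] future) simp_all
  then show ?case by (simp add: distrib_left)
qed

lemma subgaussian_walk: "subgaussian S 1 (h * real n) (\<lambda>x. walk x n)"
  using subgaussian_martingale_transform[of "\<lambda>_ _. 1" "\<lambda>_. 1" n]
  by (simp add: walk_def depends_below_def)

lemma subgaussian_forward_sum:
  assumes [measurable]: "\<phi> \<in> borel_measurable borel" and \<phi>_bound: "\<And>u. \<bar>\<phi> u\<bar> \<le> c"
  shows "subgaussian S 1 (c\<^sup>2 * h * real n) (\<lambda>x. \<Sum>i<n. \<phi> (walk x i) * x i)"
proof -
  have "subgaussian S 1 (h * (\<Sum>i<n. c\<^sup>2)) (\<lambda>x. \<Sum>i<n. \<phi> (walk x i) * x i)"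
  proof (rule subgaussian_martingale_transform)
    show "depends_below i (\<lambda>x. \<phi> (walk x i))" for i
      using depends_below_walk[of i i] by (auto simp: depends_below_def intro: arg_cong[of _ _ \<phi>])
  qed (use \<phi>_bound in measurable)
  then show ?thesis by (simp add: mult_ac)
qed

lemma measurable_reversed_step: "reversed_step i \<in> borel_measurable S"
  unfolding reversed_step_def by measurable

lemma measurable_reversed_sum [measurable]:
  "\<phi> \<in> borel_measurable borel \<Longrightarrow> reversed_sum \<phi> n \<in> borel_measurable S"
  unfolding reversed_sum_def
  by (intro borel_measurable_sum borel_measurable_times measurable_compose[OF measurable_walk]
      measurable_reversed_step)

lemma nn_integral_reversed_sum_Suc:
  fixes \<phi> :: "real \<Rightarrow> real" and g :: "real \<Rightarrow> ennreal"
  assumes [measurable]: "\<phi> \<in> borel_measurable borel" "g \<in> borel_measurable borel"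
  shows "(\<integral>\<^sup>+x. ennreal (exp (reversed_sum \<phi> (Suc n) x)) * g (walk x (Suc n)) \<partial>S)
    = (\<integral>\<^sup>+y. \<integral>\<^sup>+x. ennreal (exp (reversed_sum \<phi> n x)) *
        (ennreal (exp (\<phi> (walk x n + y) * (y - (walk x n + y) / real (Suc n)))) * g (walk x n + y))
        \<partial>S \<partial>gauss h)"
    (is "_ = (\<integral>\<^sup>+y. ?F y \<partial>gauss h)")
proof -
  have "(\<integral>\<^sup>+x. ennreal (exp (reversed_sum \<phi> (Suc n) x)) * g (walk x (Suc n)) \<partial>S)
      = (\<integral>\<^sup>+y. \<integral>\<^sup>+x. ennreal (exp (reversed_sum \<phi> (Suc n) (comb_seq n x y))) *
          g (walk (comb_seq n x y) (Suc n)) \<partial>S \<partial>S)"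
    by (rule nn_integral_comb_seq(2)) measurable
  also have "\<dots> = (\<integral>\<^sup>+y. ?F (y 0) \<partial>S)"
    by (simp only: reversed_sum_comb_seq_Suc walk_comb_seq_Suc exp_add ennreal_mult exp_ge_zero
        mult.assoc)
  also have "\<dots> = (\<integral>\<^sup>+y. ?F y \<partial>gauss h)"
    by (rule nn_integral_component[where g = ?F]) measurable
  finally show ?thesis .
qed

lemma nn_integral_reversed_sum_le:
  fixes \<phi> :: "real \<Rightarrow> real" and g :: "real \<Rightarrow> ennreal"
  assumes \<phi>_measurable [measurable]: "\<phi> \<in> borel_measurable borel" and \<phi>_bound: "\<And>u. \<bar>\<phi> u\<bar> \<le> c"
    and "1 \<le> n" "g \<in> borel_measurable borel"
  shows "(\<integral>\<^sup>+x. ennreal (exp (reversed_sum \<phi> n x)) * g (walk x n) \<partial>S)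
    \<le> ennreal (exp (c\<^sup>2 * h * real n / 2)) * (\<integral>\<^sup>+w. g w \<partial>gauss (real n * h))"
  using assms(3,4)
proof (induction n arbitrary: g rule: nat_induct_at_least)
  case base
  note base [measurable]
  have "(\<integral>\<^sup>+w. g w \<partial>gauss h) \<le> ennreal (exp (c\<^sup>2 * h / 2)) * (\<integral>\<^sup>+w. g w \<partial>gauss h)"
    using mult_right_mono[of 1 "ennreal (exp (c\<^sup>2 * h / 2))" "\<integral>\<^sup>+w. g w \<partial>gauss h"] h_pos by simp
  moreover have "(\<integral>\<^sup>+x. g (x 0) \<partial>S) = (\<integral>\<^sup>+w. g w \<partial>gauss h)"
    by (rule nn_integral_component[where g = g]) measurable
  ultimately show ?case
    by (simp add: reversed_sum_def reversed_step_def walk_Suc)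
next
  case (Suc n g)
  note Suc.prems [measurable]
  let ?G = "\<lambda>y u. ennreal (exp (\<phi> (u + y) * (y - (u + y) / real (Suc n)))) * g (u + y)"
  let ?E = "ennreal (exp (c\<^sup>2 * h * real n / 2))"
  have nh_pos: "real n * h > 0" using Suc.hyps h_pos by simp
  have variance: "real n * h + h = real (Suc n) * h" by (simp add: distrib_right)
  have "(\<integral>\<^sup>+x. ennreal (exp (reversed_sum \<phi> (Suc n) x)) * g (walk x (Suc n)) \<partial>S)
      \<le> (\<integral>\<^sup>+y. ?E * (\<integral>\<^sup>+u. ?G y u \<partial>gauss (real n * h)) \<partial>gauss h)"
    unfolding nn_integral_reversed_sum_Suc[OF \<phi>_measurable Suc.prems]
    by (intro nn_integral_mono Suc.IH) measurable
  also have "\<dots> = ?E * (\<integral>\<^sup>+y. \<integral>\<^sup>+u. ?G y u \<partial>gauss (real n * h) \<partial>gauss h)"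
    using prob_space_imp_sigma_finite[OF prob_space_gauss[OF nh_pos]]
    by (intro nn_integral_cmult sigma_finite_measure.borel_measurable_nn_integral) measurable
  also have "\<dots> \<le> ?E * (ennreal (exp (c\<^sup>2 * h / 2)) * (\<integral>\<^sup>+w. g w \<partial>gauss (real (Suc n) * h)))"
    using nn_integral_gauss_residual_le[OF nh_pos h_pos \<phi>_measurable Suc.prems \<phi>_bound] h_pos
    unfolding variance by (intro mult_left_mono) simp_all
  also have "\<dots> = ennreal (exp (c\<^sup>2 * h * real n / 2) * exp (c\<^sup>2 * h / 2)) *
      (\<integral>\<^sup>+w. g w \<partial>gauss (real (Suc n) * h))"
    by (simp only: mult.assoc ennreal_mult exp_ge_zero)
  also have "exp (c\<^sup>2 * h * real n / 2) * exp (c\<^sup>2 * h / 2) = exp (c\<^sup>2 * h * real (Suc n) / 2)"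
    unfolding exp_add[symmetric] by (simp add: distrib_left add_divide_distrib add.commute)
  finally show ?case .
qed

lemma subgaussian_reversed_sum:
  assumes \<phi>_measurable [measurable]: "\<phi> \<in> borel_measurable borel" and \<phi>_bound: "\<And>u. \<bar>\<phi> u\<bar> \<le> c"
    and n_ge_1: "1 \<le> n"
  shows "subgaussian S 1 (c\<^sup>2 * h * real n) (reversed_sum \<phi> n)"
proof (rule subgaussianI[OF measurable_reversed_sum[OF \<phi>_measurable]])
  fix \<theta>
  have scaled_bound: "\<bar>\<theta> * \<phi> u\<bar> \<le> \<bar>\<theta>\<bar> * c" for u
    using \<phi>_bound by (simp add: abs_mult mult_left_mono)
  have "real n * h > 0" using n_ge_1 h_pos by simp
  then have "(\<integral>\<^sup>+w. 1 \<partial>gauss (real n * h)) = 1"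
    using prob_space.emeasure_space_1[OF prob_space_gauss] by simp
  moreover have "(\<integral>\<^sup>+x. ennreal (exp (reversed_sum (\<lambda>u. \<theta> * \<phi> u) n x)) * 1 \<partial>S)
      \<le> ennreal (exp ((\<bar>\<theta>\<bar> * c)\<^sup>2 * h * real n / 2)) * (\<integral>\<^sup>+w. 1 \<partial>gauss (real n * h))"
    by (intro nn_integral_reversed_sum_le n_ge_1 scaled_bound) measurable
  moreover have "reversed_sum (\<lambda>u. \<theta> * \<phi> u) n x = \<theta> * reversed_sum \<phi> n x" for x
    by (simp add: reversed_sum_def sum_distrib_left mult.assoc)
  ultimately show "(\<integral>\<^sup>+x. ennreal (exp (\<theta> * reversed_sum \<phi> n x)) \<partial>S)
      \<le> ennreal (1 * exp (c\<^sup>2 * h * real n * \<theta>\<^sup>2 / 2))"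
    by (simp add: power_mult_distrib mult_ac)
qed

lemma subgaussian_reversed_drift:
  assumes [measurable]: "\<phi> \<in> borel_measurable borel" and \<phi>_bound: "\<And>u. \<bar>\<phi> u\<bar> \<le> c"
    and c_pos: "c > 0" and n_ge_1: "1 \<le> n"
  shows "subgaussian S 2 (4 * (c\<^sup>2 * h * real n))
      (\<lambda>x. \<Sum>i<n. \<phi> (walk x (Suc i)) * (walk x (Suc i) / real (Suc i)))"
proof -
  define \<sigma> where "\<sigma> i = c * sqrt h * (1 / sqrt (real (Suc i)))" for i
  have "subgaussian S 2 ((\<Sum>i<n. \<sigma> i)\<^sup>2)
      (\<lambda>x. \<Sum>i<n. \<phi> (walk x (Suc i)) * (walk x (Suc i) / real (Suc i)))"
  proof (intro subgaussian_sum)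
    fix i
    let ?k = "real (Suc i)"
    have "subgaussian S (2 * 1) ((c / ?k)\<^sup>2 * (h * ?k)) (\<lambda>x. \<bar>c / ?k * walk x (Suc i)\<bar>)"
      by (intro subgaussian_abs subgaussian_cmult subgaussian_walk) simp
    moreover have "(c / ?k)\<^sup>2 * (h * ?k) = (\<sigma> i)\<^sup>2"
      using h_pos
      by (simp add: \<sigma>_def power_mult_distrib power_divide power2_eq_square del: of_nat_Suc)
    ultimately have bound: "subgaussian S 2 ((\<sigma> i)\<^sup>2) (\<lambda>x. \<bar>c / ?k * walk x (Suc i)\<bar>)"
      by simp
    show "subgaussian S 2 ((\<sigma> i)\<^sup>2) (\<lambda>x. \<phi> (walk x (Suc i)) * (walk x (Suc i) / ?k))"
    proof (rule subgaussian_dominated[OF bound])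
      show "\<bar>\<phi> (walk x (Suc i)) * (walk x (Suc i) / ?k)\<bar> \<le> \<bar>c / ?k * walk x (Suc i)\<bar>" for x
        using mult_right_mono[OF \<phi>_bound[of "walk x (Suc i)"], of "\<bar>walk x (Suc i) / ?k\<bar>"] c_pos
        by (simp add: abs_mult del: of_nat_Suc)
    qed measurable
    show "\<sigma> i > 0" using c_pos h_pos by (simp add: \<sigma>_def)
  qed (use n_ge_1 in \<open>auto simp: lessThan_empty_iff\<close>)
  moreover have "(\<Sum>i<n. \<sigma> i)\<^sup>2 \<le> 4 * (c\<^sup>2 * h * real n)"
  proof -
    have "(\<Sum>i<n. \<sigma> i) \<le> c * sqrt h * (2 * sqrt (real n))"
      unfolding \<sigma>_def sum_distrib_left[symmetric]
      using c_pos h_pos by (intro mult_left_mono sum_inverse_sqrt_le) simp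
    moreover have "0 \<le> (\<Sum>i<n. \<sigma> i)" using c_pos h_pos by (intro sum_nonneg) (simp add: \<sigma>_def)
    ultimately have "(\<Sum>i<n. \<sigma> i)\<^sup>2 \<le> (c * sqrt h * (2 * sqrt (real n)))\<^sup>2" by (rule power_mono)
    then show ?thesis using h_pos by (simp add: power_mult_distrib mult_ac)
  qed
  ultimately show ?thesis by (rule subgaussian_mono[OF _ zero_le_numeral order_refl])
qed

text \<open>The covariation sum is a reversed martingale plus the drift of the reversed walk minus a forward
  martingale, with standard deviations \<open>\<sigma>\<close>, \<open>2 \<sigma>\<close> and \<open>\<sigma>\<close>.\<close>

lemma subgaussian_covariation_sum:
  assumes \<phi>_measurable [measurable]: "\<phi> \<in> borel_measurable borel" and \<phi>_bound: "\<And>u. \<bar>\<phi> u\<bar> \<le> c"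
    and c_pos: "c > 0"
  shows "subgaussian S 2 (16 * (c\<^sup>2 * h * real n))
      (\<lambda>x. \<Sum>i<n. (\<phi> (walk x (Suc i)) - \<phi> (walk x i)) * x i)"
proof (cases "n = 0")
  case True
  then show ?thesis using subgaussian_mono[OF P.subgaussian_zero] by simp
next
  case False
  define \<sigma> where "\<sigma> = sqrt (c\<^sup>2 * h * real n)"
  have \<sigma>_props: "\<sigma> > 0" "\<sigma>\<^sup>2 = c\<^sup>2 * h * real n" using False c_pos h_pos by (auto simp: \<sigma>_def)
  let ?drift = "\<lambda>x. \<Sum>i<n. \<phi> (walk x (Suc i)) * (walk x (Suc i) / real (Suc i))"
  let ?forward = "\<lambda>x. \<Sum>i<n. \<phi> (walk x i) * x i"
  have "subgaussian S 2 (\<sigma>\<^sup>2) (reversed_sum \<phi> n)"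
    unfolding \<sigma>_props using False
    by (intro subgaussian_mono[OF subgaussian_reversed_sum[OF \<phi>_measurable \<phi>_bound]]) auto
  moreover have "subgaussian S 2 ((2 * \<sigma>)\<^sup>2) ?drift"
    using subgaussian_reversed_drift[OF \<phi>_measurable \<phi>_bound c_pos, of n] False
    by (simp add: power_mult_distrib \<sigma>_props(2))
  moreover have "subgaussian S 2 (\<sigma>\<^sup>2) (\<lambda>x. - ?forward x)"
    unfolding \<sigma>_props
    by (intro subgaussian_uminus
        subgaussian_mono[OF subgaussian_forward_sum[OF \<phi>_measurable \<phi>_bound]]) auto
  ultimately have "subgaussian S 2 ((\<sigma> + 2 * \<sigma> + \<sigma>)\<^sup>2)
      (\<lambda>x. reversed_sum \<phi> n x + ?drift x + - ?forward x)"
    using \<sigma>_props(1) by (intro subgaussian_add) auto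
  moreover have "reversed_sum \<phi> n x + ?drift x + - ?forward x
      = (\<Sum>i<n. (\<phi> (walk x (Suc i)) - \<phi> (walk x i)) * x i)" for x
    by (simp add: reversed_sum_def reversed_step_def sum.distrib[symmetric] sum_negf[symmetric]
        algebra_simps)
  moreover have "(\<sigma> + 2 * \<sigma> + \<sigma>)\<^sup>2 = 16 * (c\<^sup>2 * h * real n)"
    by (simp add: power_mult_distrib \<sigma>_props(2))
  ultimately show ?thesis by simp
qed

end

subsection \<open>Covariation sums over several blocks\<close>

text \<open>On a block of the grid, \<open>m\<close> is the left end, and \<open>\<phi> z u\<close> the integrand at \<open>u\<close> centred at its value
  in \<open>z\<close>.\<close>

definition cov_term :: "(real \<Rightarrow> real \<Rightarrow> real) \<Rightarrow> nat \<Rightarrow> nat \<Rightarrow> (nat \<Rightarrow> real) \<Rightarrow> real" where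
  "cov_term \<phi> m i x = (\<phi> (walk x m) (walk x (Suc i)) - \<phi> (walk x m) (walk x i)) * x i"

lemma depends_below_cov_term:
  assumes "m \<le> n" "i < n"
  shows "depends_below n (cov_term \<phi> m i)"
proof -
  have "depends_below n (\<lambda>x. walk x m)" "depends_below n (\<lambda>x. walk x i)"
      "depends_below n (\<lambda>x. walk x (Suc i))" "depends_below n (\<lambda>x. x i)"
    using assms by (auto intro!: depends_below_walk depends_below_component)
  then show ?thesis unfolding depends_below_def cov_term_def by metis
qed

lemma walk_diff: "m \<le> n \<Longrightarrow> walk x n - walk x m = (\<Sum>i=m..<n. x i)"
  by (induction n rule: dec_induct) (simp_all add: walk_Suc)

text \<open>Stopping the walk keeps it a martingale transform, so the Chernoff bound for the stopped walk takes
  the place of Doob's maximal inequality.\<close>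

definition stopped_increment :: "real \<Rightarrow> nat \<Rightarrow> nat \<Rightarrow> (nat \<Rightarrow> real) \<Rightarrow> real" where
  "stopped_increment q b n x =
    (\<Sum>i<n. (if b \<le> i \<and> (\<forall>j\<in>{b..i}. \<bar>walk x j - walk x b\<bar> < q) then 1 else 0) * x i)"

lemma abs_stopped_increment_ge:
  assumes "b \<le> i" "i \<le> n" "q \<le> \<bar>walk x i - walk x b\<bar>"
  shows "q \<le> \<bar>stopped_increment q b n x\<bar>"
proof -
  define \<tau> where "\<tau> = (LEAST j. b \<le> j \<and> q \<le> \<bar>walk x j - walk x b\<bar>)"
  have hit: "b \<le> \<tau>" "q \<le> \<bar>walk x \<tau> - walk x b\<bar>"
    using LeastI[of "\<lambda>j. b \<le> j \<and> q \<le> \<bar>walk x j - walk x b\<bar>" i] assms by (auto simp: \<tau>_def)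
  have "\<tau> \<le> n" using assms unfolding \<tau>_def by (intro order_trans[OF Least_le]) auto
  have first: "\<bar>walk x j - walk x b\<bar> < q" if "b \<le> j" "j < \<tau>" for j
    using not_less_Least[OF that(2)[unfolded \<tau>_def]] that(1) by auto
  have "b \<le> k \<and> (\<forall>j\<in>{b..k}. \<bar>walk x j - walk x b\<bar> < q) \<longleftrightarrow> k \<in> {b..<\<tau>}" for k
  proof (cases "k < \<tau>")
    case True
    then show ?thesis using first by auto
  next
    case False
    then show ?thesis using hit by (auto simp: not_less[symmetric])
  qed
  then have "stopped_increment q b n x = (\<Sum>k<n. (if k \<in> {b..<\<tau>} then 1 else 0) * x k)"
    by (simp add: stopped_increment_def)
  also have "\<dots> = sum x ({..<n} \<inter> {b..<\<tau>})"
    by (simp add: sum.inter_restrict if_distrib[of "\<lambda>u. u * _"] cong: if_cong)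
  also have "{..<n} \<inter> {b..<\<tau>} = {b..<\<tau>}" using \<open>\<tau> \<le> n\<close> by auto
  also have "sum x {b..<\<tau>} = walk x \<tau> - walk x b" by (rule walk_diff[OF hit(1), symmetric])
  finally show ?thesis using hit(2) by simp
qed

context gaussian_walk
begin

lemma measurable_cov_term:
  assumes [measurable]: "case_prod \<phi> \<in> borel_measurable (borel \<Otimes>\<^sub>M borel)"
  shows "cov_term \<phi> m i \<in> borel_measurable S"
  unfolding cov_term_def by measurable

lemma subgaussian_future_cov_terms:
  assumes [measurable]: "case_prod \<phi> \<in> borel_measurable (borel \<Otimes>\<^sub>M borel)"
    and \<phi>_bound: "\<And>z u. \<bar>\<phi> z u\<bar> \<le> c" and c_pos: "c > 0" and m_le: "m \<le> b"
  shows "subgaussian S 2 (16 * (c\<^sup>2 * h * real l))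
      (\<lambda>y. \<Sum>i<l. cov_term \<phi> m (b + i) (comb_seq b x y))"
proof -
  define \<psi> where "\<psi> u = \<phi> (walk x m) (walk x b + u)" for u
  have [measurable]: "\<psi> \<in> borel_measurable borel" unfolding \<psi>_def by measurable
  have "cov_term \<phi> m (b + i) (comb_seq b x y) = (\<psi> (walk y (Suc i)) - \<psi> (walk y i)) * y i" for i y
    using walk_comb_seq_add[of b x y i] walk_comb_seq_add[of b x y "Suc i"]
    by (simp add: cov_term_def \<psi>_def walk_comb_seq_le[OF m_le]
        comb_seq_add[of b x y i, unfolded add.commute[of i]])
  then show ?thesis
    using subgaussian_covariation_sum[of \<psi> c l] \<phi>_bound c_pos by (simp add: \<psi>_def)
qed

text \<open>Conditionally on its past, each block of length \<open>L\<close> contributes a factor \<open>2\<close>.\<close>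

lemma subgaussian_block_cov_terms:
  assumes \<phi>_measurable: "case_prod \<phi> \<in> borel_measurable (borel \<Otimes>\<^sub>M borel)"
    and \<phi>_bound: "\<And>z u. \<bar>\<phi> z u\<bar> \<le> c" and c_pos: "c > 0" and "a \<le> e" "e \<le> (a div L + K) * L"
  shows "subgaussian S (2 ^ K) (16 * (c\<^sup>2 * h * real (e - a)))
      (\<lambda>x. \<Sum>i=a..<e. cov_term \<phi> (i div L * L) i x)"
  using assms(4,5)
proof (induction K arbitrary: e)
  case 0
  then have "e \<le> a div L * L" by simp
  also have "\<dots> \<le> a" by (rule div_times_less_eq_dividend)
  finally have "e = a" using 0(1) by simp
  then show ?case using P.subgaussian_zero by simp
next
  case (Suc K)
  define s where "s = (a div L + K) * L"
  let ?X = "\<lambda>a e x. \<Sum>i=a..<e. cov_term \<phi> (i div L * L) i x"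
  define p where "p = min e (max a s)"
  have p_between: "a \<le> p" "p \<le> e" using Suc.prems by (auto simp: p_def)
  have past: "subgaussian S (2 ^ K) (16 * (c\<^sup>2 * h * real (p - a))) (?X a p)"
  proof (cases "p \<le> s")
    case True
    then show ?thesis using Suc.IH p_between by (simp add: s_def)
  next
    case False
    then have "p = a" using p_between by (auto simp: p_def)
    then show ?thesis using subgaussian_mono[OF P.subgaussian_zero, of "2 ^ K"] by simp
  qed
  have past_depends: "depends_below p (?X a p)"
    by (intro depends_below_sum depends_below_cov_term)
       (auto intro: order_trans[OF div_times_less_eq_dividend])
  have future: "subgaussian S 2 (16 * (c\<^sup>2 * h * real (e - p))) (\<lambda>y. ?X p e (comb_seq p x y))" for x
  proof (cases "p = e")
    case True
    then show ?thesis using subgaussian_mono[OF P.subgaussian_zero, of 2] by simp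
  next
    case False
    then have "s \<le> p" "e \<le> s + L" using Suc.prems by (auto simp: p_def s_def)
    have "i div L = a div L + K" if "i \<in> {p..<e}" for i
      using that \<open>s \<le> p\<close> \<open>e \<le> s + L\<close> unfolding s_def
      by (intro div_nat_eqI) (auto simp: mult.commute)
    then have "?X p e x = (\<Sum>i<e - p. cov_term \<phi> s (p + i) x)" for x
      by (simp add: s_def sum.atLeastLessThan_shift_0[of _ p e] atLeast0LessThan)
    then show ?thesis
      using subgaussian_future_cov_terms[OF \<phi>_measurable \<phi>_bound c_pos \<open>s \<le> p\<close>, of "e - p" x]
      by simp
  qed
  have "?X p e \<in> borel_measurable S"
    by (intro borel_measurable_sum measurable_cov_term \<phi>_measurable)
  then have "subgaussian S (2 ^ K * 2)
      (16 * (c\<^sup>2 * h * real (p - a)) + 16 * (c\<^sup>2 * h * real (e - p)))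
      (\<lambda>x. ?X a p x + ?X p e x)"
    by (intro subgaussian_add_future[OF past past_depends] future) simp_all
  moreover have "real (e - a) = real (p - a) + real (e - p)" using p_between by simp
  ultimately show ?case
    by (simp add: sum.atLeastLessThan_concat[OF p_between] distrib_left mult.commute)
qed

lemma subgaussian_stopped_increment: "subgaussian S 1 (h * real l) (stopped_increment q b (b + l))"
proof -
  define H :: "nat \<Rightarrow> (nat \<Rightarrow> real) \<Rightarrow> real" where
    "H i x = (if b \<le> i \<and> (\<forall>j\<in>{b..i}. \<bar>walk x j - walk x b\<bar> < q) then 1 else 0)" for i x
  have "subgaussian S 1 (h * (\<Sum>i<b + l. (if b \<le> i then 1 else 0)\<^sup>2)) (\<lambda>x. \<Sum>i<b + l. H i x * x i)"
  proof (rule subgaussian_martingale_transform)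
    show "H i \<in> borel_measurable S" for i unfolding H_def by measurable
    show "depends_below i (H i)" for i
      unfolding depends_below_def
    proof (intro allI impI)
      fix x y :: "nat \<Rightarrow> real" assume "\<forall>j<i. x j = y j"
      then have "walk x j = walk y j" if "j \<le> i" for j
        using depends_below_walk[OF that] by (simp add: depends_below_def)
      then show "H i x = H i y" by (auto simp: H_def)
    qed
  qed (simp add: H_def)
  moreover have "(\<Sum>i<b + l. (if b \<le> i then 1 else 0 :: real)\<^sup>2) = real l"
  proof -
    have "{..<b + l} \<inter> {i. b \<le> i} = {b..<b + l}" by auto
    then show ?thesis by (simp add: if_distrib[of "\<lambda>u. u\<^sup>2"] sum.If_cases)
  qed
  ultimately show ?thesis by (simp add: stopped_increment_def[abs_def] H_def)
qed

end

subsection \<open>Brownian motion on a uniform grid\<close>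

lemma brownian_motionD:
  assumes "brownian_motion M W"
  shows "prob_space M" "\<And>t. t \<ge> 0 \<Longrightarrow> W t \<in> borel_measurable M"
    "\<And>\<omega>. \<omega> \<in> space M \<Longrightarrow> W 0 \<omega> = 0"
    "\<And>m t. 0 \<le> t 0 \<Longrightarrow> (\<And>i. i < m \<Longrightarrow> t i \<le> t (Suc i)) \<Longrightarrow>
      prob_space.indep_vars M (\<lambda>_. borel) (\<lambda>i \<omega>. W (t (Suc i)) \<omega> - W (t i) \<omega>) {..<m :: nat}"
    "\<And>s t. 0 \<le> s \<Longrightarrow> s < t \<Longrightarrow>
      distributed M lborel (\<lambda>\<omega>. W t \<omega> - W s \<omega>) (normal_density 0 (sqrt (t - s)))"
  using assms unfolding brownian_motion_def by blast+

definition increments :: "(real \<Rightarrow> 'a \<Rightarrow> real) \<Rightarrow> real \<Rightarrow> 'a \<Rightarrow> nat \<Rightarrow> real" where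
  "increments W h \<omega> i = W (real (Suc i) * h) \<omega> - W (real i * h) \<omega>"

lemma walk_increments:
  assumes "brownian_motion M W" "\<omega> \<in> space M"
  shows "walk (increments W h \<omega>) n = W (real n * h) \<omega>"
proof (induction n)
  case 0
  show ?case using brownian_motionD(3)[OF assms] by simp
next
  case (Suc n)
  then show ?case by (simp add: walk_Suc increments_def)
qed

context gaussian_walk
begin

lemma brownian_motion_measurable_grid:
  assumes "brownian_motion M W"
  shows "W (real i * h) \<in> borel_measurable M"
  using brownian_motionD(2)[OF assms] h_pos by simp

lemma measurable_increments:
  assumes "brownian_motion M W"
  shows "increments W h \<in> measurable M S"
proof -
  note brownian_motion_measurable_grid[OF assms, measurable]
  have "(\<lambda>\<omega>. \<lambda>i\<in>UNIV. W (real (Suc i) * h) \<omega> - W (real i * h) \<omega>) \<in> measurable M S"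
    by (intro measurable_restrict) measurable
  then show ?thesis by (simp add: increments_def[abs_def] restrict_UNIV)
qed

lemma distr_brownian_increment:
  assumes BM: "brownian_motion M W"
  shows "distr M borel (\<lambda>\<omega>. increments W h \<omega> i) = gauss h"
proof -
  have "distributed M lborel (\<lambda>\<omega>. increments W h \<omega> i) (normal_density 0 (sqrt h))"
    using brownian_motionD(5)[OF BM, of "real i * h" "real (Suc i) * h"] h_pos
    by (simp add: increments_def algebra_simps)
  from distributed_distr_eq_density[OF this]
  have "distr M lborel (\<lambda>\<omega>. increments W h \<omega> i) = gauss h"
    by (simp add: gauss_def)
  moreover have "distr M lborel (\<lambda>\<omega>. increments W h \<omega> i) = distr M borel (\<lambda>\<omega>. increments W h \<omega> i)"
    by (intro distr_cong) auto
  ultimately show ?thesis by simp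
qed

lemma indep_vars_increments:
  assumes BM: "brownian_motion M W"
  shows "prob_space.indep_vars M (\<lambda>_. borel) (\<lambda>i \<omega>. increments W h \<omega> i) UNIV"
proof -
  interpret prob_space M by (rule brownian_motionD[OF BM])
  have "indep_vars (\<lambda>_. borel) (\<lambda>i \<omega>. increments W h \<omega> i) J" if "finite J" for J
  proof -
    obtain m where J_subset: "J \<subseteq> {..<m}" using \<open>finite J\<close> finite_nat_set_iff_bounded by auto
    have "indep_vars (\<lambda>_. borel) (\<lambda>i \<omega>. increments W h \<omega> i) {..<m}"
      using brownian_motionD(4)[OF BM, of "\<lambda>i. real i * h" m] h_pos
      by (simp add: increments_def mult_right_mono)
    then show ?thesis by (rule indep_vars_subset[OF _ J_subset])
  qed
  then show ?thesis
    unfolding indep_vars_def2 by (subst indep_sets_finite_index_sets) auto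
qed

lemma distr_increments:
  assumes BM: "brownian_motion M W"
  shows "distr M S (increments W h) = S"
proof -
  interpret prob_space M by (rule brownian_motionD[OF BM])
  have "distr M S (increments W h) = distr M (\<Pi>\<^sub>M i\<in>UNIV. borel) (\<lambda>\<omega>. \<lambda>i\<in>UNIV. increments W h \<omega> i)"
    by (intro distr_cong sets_PiM_cong) auto
  also have "\<dots> = (\<Pi>\<^sub>M i\<in>UNIV. distr M borel (\<lambda>\<omega>. increments W h \<omega> i))"
  proof (subst indep_vars_iff_distr_eq_PiM[symmetric])
    show "(\<lambda>\<omega>. increments W h \<omega> i) \<in> borel_measurable M" for i
      using measurable_compose[OF measurable_increments[OF BM] measurable_component] .
  qed (simp_all add: indep_vars_increments[OF BM])
  also have "\<dots> = S"
    by (simp add: distr_brownian_increment[OF BM])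
  finally show ?thesis .
qed

lemma subgaussian_increments:
  assumes BM: "brownian_motion M W" and subgaussian_X: "subgaussian S B v X"
  shows "subgaussian M B v (\<lambda>\<omega>. X (increments W h \<omega>))"
  using subgaussian_X
  by (intro subgaussian_distr[OF measurable_increments[OF BM]]) (simp add: distr_increments[OF BM])

lemma prob_brownian_grid_maximal:
  assumes BM: "brownian_motion M W" and l_pos: "l > 0" and q_pos: "q > 0"
  shows "measure M {\<omega> \<in> space M. \<exists>i\<le>l. q \<le> \<bar>W (real (b + i) * h) \<omega> - W (real b * h) \<omega>\<bar>}
    \<le> 2 * exp (- (q\<^sup>2 / (2 * (h * real l))))"
proof -
  interpret prob_space M by (rule brownian_motionD[OF BM])
  let ?X = "\<lambda>\<omega>. stopped_increment q b (b + l) (increments W h \<omega>)"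
  have subgaussian_X: "subgaussian M 1 (h * real l) ?X"
    by (rule subgaussian_increments[OF BM subgaussian_stopped_increment])
  have "prob {\<omega> \<in> space M. \<exists>i\<le>l. q \<le> \<bar>W (real (b + i) * h) \<omega> - W (real b * h) \<omega>\<bar>}
      \<le> prob {\<omega> \<in> space M. q \<le> \<bar>?X \<omega>\<bar>}"
  proof (rule finite_measure_mono)
    show "{\<omega> \<in> space M. \<exists>i\<le>l. q \<le> \<bar>W (real (b + i) * h) \<omega> - W (real b * h) \<omega>\<bar>}
        \<subseteq> {\<omega> \<in> space M. q \<le> \<bar>?X \<omega>\<bar>}"
    proof safe
      fix \<omega> i assume "\<omega> \<in> space M" "i \<le> l" "q \<le> \<bar>W (real (b + i) * h) \<omega> - W (real b * h) \<omega>\<bar>"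
      then show "q \<le> \<bar>?X \<omega>\<bar>"
        by (intro abs_stopped_increment_ge[of b "b + i"])
           (simp_all add: walk_increments[OF BM] del: of_nat_add)
    qed
    show "{\<omega> \<in> space M. q \<le> \<bar>?X \<omega>\<bar>} \<in> events"
      using subgaussian_measurable[OF subgaussian_X] by measurable
  qed
  also have "\<dots> \<le> 2 * 1 * exp (- (q\<^sup>2 / (2 * (h * real l))))"
    using l_pos h_pos q_pos by (intro subgaussian_tail[OF subgaussian_X]) auto
  finally show ?thesis by simp
qed

lemma prob_brownian_block_cov_tail:
  assumes BM: "brownian_motion M W"
    and \<phi>_measurable: "case_prod \<phi> \<in> borel_measurable (borel \<Otimes>\<^sub>M borel)"
    and \<phi>_bound: "\<And>z u. \<bar>\<phi> z u\<bar> \<le> c" and c_pos: "c > 0" and block: "a \<le> e" "e \<le> (a div L + K) * L"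
    and r_bounds: "h * real (e - a) \<le> r" "r > 0" and g_pos: "g > 0"
  shows "measure M {\<omega> \<in> space M. g \<le> \<bar>\<Sum>i=a..<e. cov_term \<phi> (i div L * L) i (increments W h \<omega>)\<bar>}
    \<le> 2 * 2 ^ K * exp (- (g\<^sup>2 / (32 * c\<^sup>2 * r)))"
proof -
  interpret prob_space M by (rule brownian_motionD[OF BM])
  have "16 * (c\<^sup>2 * h * real (e - a)) \<le> 16 * c\<^sup>2 * r"
    using r_bounds(1) by (simp add: mult.assoc mult_left_mono)
  then have "subgaussian S (2 ^ K) (16 * c\<^sup>2 * r) (\<lambda>x. \<Sum>i=a..<e. cov_term \<phi> (i div L * L) i x)"
    by (intro subgaussian_mono[OF subgaussian_block_cov_terms[OF \<phi>_measurable \<phi>_bound c_pos block]])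
       auto
  from subgaussian_tail[OF subgaussian_increments[OF BM this], of g]
  show ?thesis using c_pos r_bounds g_pos by (simp add: mult.assoc)
qed

end

subsection \<open>Quadratic covariation along refining grids\<close>

lemma partition_of_nonneg:
  assumes "partition_of p N t" "i \<le> N"
  shows "p i \<ge> 0"
  using assms(2)
proof (induction i)
  case 0
  then show ?case using assms(1) by (simp add: partition_of_def)
next
  case (Suc i)
  then have "p i < p (Suc i)" using assms(1) by (simp add: partition_of_def)
  with Suc show ?case by simp
qed

lemma partition_of_0:
  assumes "partition_of p N 0"
  shows "N = 0"
proof (rule ccontr)
  assume "N \<noteq> 0"
  then obtain k where N_eq: "N = Suc k" by (cases N) auto
  then have "p k < p N" "p k \<ge> 0"
    using assms partition_of_nonneg[OF assms, of k] by (auto simp: partition_of_def)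
  then show False using assms by (simp add: partition_of_def)
qed

lemma partition_of_uniform_grid: "h > 0 \<Longrightarrow> partition_of (\<lambda>i. real i * h) N (real N * h)"
  by (simp add: partition_of_def)

lemma is_qcov_0: "is_qcov M X Y 0 (\<lambda>_. 0)"
  unfolding is_qcov_def by (auto dest!: partition_of_0 simp: cov_sum_def intro!: exI[of _ 1])

lemma is_qcov_measurable: "is_qcov M X Y t C \<Longrightarrow> C \<in> borel_measurable M"
  by (simp add: is_qcov_def)

lemma measurable_cov_sum:
  assumes "\<And>i. X (p i) \<in> borel_measurable M" "\<And>i. Y (p i) \<in> borel_measurable M"
  shows "cov_sum X Y p N \<in> borel_measurable M"
  unfolding cov_sum_def
  by (intro borel_measurable_sum borel_measurable_times borel_measurable_diff assms)

lemma cov_sum_diff: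
  assumes "a \<le> e"
  shows "cov_sum X Y p e \<omega> - cov_sum X Y p a \<omega>
    = (\<Sum>i=a..<e. (X (p (Suc i)) \<omega> - X (p i) \<omega>) * (Y (p (Suc i)) \<omega> - Y (p i) \<omega>))"
  unfolding cov_sum_def atLeast0LessThan[symmetric] by (rule sum_diff_nat_ivl[OF le0 assms])

lemma eventually_qcov_uniform_grid:
  assumes qcov_C: "is_qcov M X Y (real j * h) C" and h_pos: "h > 0" and e\<eta>_pos: "e > 0" "\<eta> > 0"
  shows "eventually (\<lambda>r. measure M {\<omega> \<in> space M.
    \<bar>cov_sum X Y (\<lambda>i. real i * (h / 2 ^ r)) (j * 2 ^ r) \<omega> - C \<omega>\<bar> > e} < \<eta>) sequentially"
proof -
  obtain d where d_pos: "d > 0"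
    and close: "\<And>m p. partition_of p m (real j * h) \<and> (\<forall>i<m. p (Suc i) - p i < d) \<Longrightarrow>
      measure M {\<omega> \<in> space M. \<bar>cov_sum X Y p m \<omega> - C \<omega>\<bar> > e} < \<eta>"
    using conjunct2[OF qcov_C[unfolded is_qcov_def], rule_format, OF e\<eta>_pos] by blast
  have "(\<lambda>r. h * (1 / 2) ^ r) \<longlonglongrightarrow> h * 0"
    by (intro tendsto_mult tendsto_const LIMSEQ_power_zero) simp
  then have "eventually (\<lambda>r. h / 2 ^ r < d) sequentially"
    using order_tendstoD(2)[of _ "h * 0" sequentially d] d_pos by (simp add: power_divide)
  then show ?thesis
  proof eventually_elim
    case (elim r)
    have "partition_of (\<lambda>i. real i * (h / 2 ^ r)) (j * 2 ^ r) (real j * h)"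
      using partition_of_uniform_grid[of "h / 2 ^ r" "j * 2 ^ r"] h_pos by simp
    moreover have "real (Suc i) * (h / 2 ^ r) - real i * (h / 2 ^ r) < d" for i
      using elim by (simp add: distrib_right add_divide_distrib)
    ultimately show ?case by (intro close) auto
  qed
qed

lemma (in prob_space) qcov_increment_tail:
  assumes XY_measurable: "\<And>u. u \<ge> 0 \<Longrightarrow> X u \<in> borel_measurable M"
      "\<And>u. u \<ge> 0 \<Longrightarrow> Y u \<in> borel_measurable M"
    and h_pos: "h > 0" and qcov_U: "is_qcov M X Y (real j * h) U"
    and qcov_V: "is_qcov M X Y (real k * h) V"
    and a_pos: "a > 0" and G_events: "G \<in> events"
    and tail: "\<And>r. prob {\<omega> \<in> G. \<bar>cov_sum X Y (\<lambda>i. real i * (h / 2 ^ r)) (k * 2 ^ r) \<omega>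
      - cov_sum X Y (\<lambda>i. real i * (h / 2 ^ r)) (j * 2 ^ r) \<omega>\<bar> > a / 2} \<le> \<beta>"
  shows "prob {\<omega> \<in> G. \<bar>V \<omega> - U \<omega>\<bar> > a} \<le> \<beta>"
proof (rule field_le_epsilon)
  fix \<eta> :: real assume "\<eta> > 0"
  then have quarter_pos: "a / 4 > 0" "\<eta> / 2 > 0" using a_pos by auto
  define S where "S r j = cov_sum X Y (\<lambda>i. real i * (h / 2 ^ r)) (j * 2 ^ r)" for r j
  obtain r where U_close: "prob {\<omega> \<in> space M. \<bar>S r j \<omega> - U \<omega>\<bar> > a / 4} < \<eta> / 2"
    and V_close: "prob {\<omega> \<in> space M. \<bar>S r k \<omega> - V \<omega>\<bar> > a / 4} < \<eta> / 2"
    using eventually_happens[OF eventually_conj[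
          OF eventually_qcov_uniform_grid[OF qcov_U h_pos quarter_pos]
             eventually_qcov_uniform_grid[OF qcov_V h_pos quarter_pos]]]
    unfolding S_def by auto
  have [measurable]: "S r j \<in> borel_measurable M" for j
    unfolding S_def using h_pos by (intro measurable_cov_sum XY_measurable) auto
  note [measurable] = is_qcov_measurable[OF qcov_U] is_qcov_measurable[OF qcov_V] G_events
  let ?A = "{\<omega> \<in> space M. \<omega> \<in> G \<and> \<bar>S r k \<omega> - S r j \<omega>\<bar> > a / 2}"
  let ?BU = "{\<omega> \<in> space M. \<bar>S r j \<omega> - U \<omega>\<bar> > a / 4}"
  let ?BV = "{\<omega> \<in> space M. \<bar>S r k \<omega> - V \<omega>\<bar> > a / 4}"
  have "{\<omega> \<in> G. \<bar>V \<omega> - U \<omega>\<bar> > a} \<subseteq> ?A \<union> (?BU \<union> ?BV)"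
  proof
    fix \<omega> assume exceeds: "\<omega> \<in> {\<omega> \<in> G. \<bar>V \<omega> - U \<omega>\<bar> > a}"
    have "\<bar>V \<omega> - U \<omega>\<bar> \<le> \<bar>S r k \<omega> - S r j \<omega>\<bar> + \<bar>S r j \<omega> - U \<omega>\<bar> + \<bar>S r k \<omega> - V \<omega>\<bar>" by linarith
    with exceeds sets.sets_into_space[OF G_events] show "\<omega> \<in> ?A \<union> (?BU \<union> ?BV)" by auto
  qed
  then have "prob {\<omega> \<in> G. \<bar>V \<omega> - U \<omega>\<bar> > a} \<le> prob (?A \<union> (?BU \<union> ?BV))"
    by (intro finite_measure_mono) measurable
  also have "\<dots> \<le> prob ?A + (prob ?BU + prob ?BV)"
    by (intro order_trans[OF measure_Un_le] add_left_mono measure_Un_le) measurable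
  also have "?A = {\<omega> \<in> G. \<bar>S r k \<omega> - S r j \<omega>\<bar> > a / 2}"
    using sets.sets_into_space[OF G_events] by auto
  also have "prob \<dots> + (prob ?BU + prob ?BV) \<le> \<beta> + (\<eta> / 2 + \<eta> / 2)"
    using U_close V_close tail[of r] by (intro add_mono) (auto simp: S_def)
  finally show "prob {\<omega> \<in> G. \<bar>V \<omega> - U \<omega>\<bar> > a} \<le> \<beta> + \<eta>" by simp
qed

subsection \<open>Paths confined on every block\<close>

definition confined :: "(real \<Rightarrow> 'a \<Rightarrow> real) \<Rightarrow> nat \<Rightarrow> real \<Rightarrow> real \<Rightarrow> nat \<Rightarrow> 'a \<Rightarrow> bool" where
  "confined W n \<delta> q m \<omega> \<longleftrightarrow> (\<forall>k<n. \<forall>i\<le>2 ^ m.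
    \<bar>W (real (k * 2 ^ m + i) * (\<delta> / 2 ^ m)) \<omega> - W (real (k * 2 ^ m) * (\<delta> / 2 ^ m)) \<omega>\<bar> < q)"

lemma confined_SucD:
  assumes "confined W n \<delta> q (Suc m) \<omega>"
  shows "confined W n \<delta> q m \<omega>"
  unfolding confined_def
proof (intro allI impI)
  fix k i :: nat assume k_less: "k < n" and i_le: "i \<le> 2 ^ m"
  have same_time: "real (k * 2 ^ Suc m + 2 * i) * (\<delta> / 2 ^ Suc m)
      = real (k * 2 ^ m + i) * (\<delta> / 2 ^ m)"
      "real (k * 2 ^ Suc m) * (\<delta> / 2 ^ Suc m) = real (k * 2 ^ m) * (\<delta> / 2 ^ m)"
    by (simp_all add: field_simps)
  have "2 * i \<le> 2 ^ Suc m" using i_le by simp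
  with assms k_less show "\<bar>W (real (k * 2 ^ m + i) * (\<delta> / 2 ^ m)) \<omega>
      - W (real (k * 2 ^ m) * (\<delta> / 2 ^ m)) \<omega>\<bar> < q"
    unfolding confined_def same_time[symmetric] by blast
qed

lemma sets_not_confined:
  assumes "brownian_motion M W" "\<delta> > 0"
  shows "{\<omega> \<in> space M. \<not> confined W n \<delta> q m \<omega>} \<in> sets M"
proof -
  have [measurable]: "W (real j * (\<delta> / 2 ^ m)) \<in> borel_measurable M" for j
    using assms by (simp add: brownian_motionD(2))
  show ?thesis unfolding confined_def by measurable
qed

lemma prob_not_confined_le:
  assumes BM: "brownian_motion M W" and \<delta>_pos: "\<delta> > 0" and q_pos: "q > 0"
  shows "measure M {\<omega> \<in> space M. \<not> confined W n \<delta> q m \<omega>} \<le> real n * (2 * exp (- (q\<^sup>2 / (2 * \<delta>))))"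
proof -
  interpret prob_space M by (rule brownian_motionD[OF BM])
  interpret G: gaussian_walk "\<delta> / 2 ^ m" by standard (use \<delta>_pos in simp)
  let ?D = "\<lambda>k. {\<omega> \<in> space M. \<exists>i\<le>2 ^ m. q \<le>
    \<bar>W (real (k * 2 ^ m + i) * (\<delta> / 2 ^ m)) \<omega> - W (real (k * 2 ^ m) * (\<delta> / 2 ^ m)) \<omega>\<bar>}"
  have exit_events: "?D k \<in> events" for k
  proof -
    note G.brownian_motion_measurable_grid[OF BM, measurable]
    show ?thesis by measurable
  qed
  have "{\<omega> \<in> space M. \<not> confined W n \<delta> q m \<omega>} = (\<Union>k\<in>{..<n}. ?D k)"
    unfolding confined_def not_all not_imp not_less by blast
  then have "prob {\<omega> \<in> space M. \<not> confined W n \<delta> q m \<omega>} \<le> (\<Sum>k<n. prob (?D k))"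
    by (simp only:) (rule measure_UNION_le[OF finite_lessThan exit_events])
  also have "\<dots> \<le> (\<Sum>k<n. 2 * exp (- (q\<^sup>2 / (2 * ((\<delta> / 2 ^ m) * real (2 ^ m))))))"
    using q_pos by (intro sum_mono G.prob_brownian_grid_maximal[OF BM]) auto
  finally show ?thesis by simp
qed

lemma prob_ex_not_confined_le:
  assumes BM: "brownian_motion M W" and \<delta>_pos: "\<delta> > 0" and q_pos: "q > 0"
  shows "measure M {\<omega> \<in> space M. \<exists>m. \<not> confined W n \<delta> q m \<omega>}
      \<le> real n * (2 * exp (- (q\<^sup>2 / (2 * \<delta>))))"
proof -
  interpret prob_space M by (rule brownian_motionD[OF BM])
  let ?B = "\<lambda>m. {\<omega> \<in> space M. \<not> confined W n \<delta> q m \<omega>}"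
  have "(\<lambda>m. prob (?B m)) \<longlonglongrightarrow> prob (\<Union>m. ?B m)"
    using sets_not_confined[OF BM \<delta>_pos]
    by (intro finite_Lim_measure_incseq incseq_SucI) (auto dest: confined_SucD)
  then have "prob (\<Union>m. ?B m) \<le> real n * (2 * exp (- (q\<^sup>2 / (2 * \<delta>))))"
    by (rule LIMSEQ_le_const2) (use prob_not_confined_le[OF assms] in auto)
  moreover have "(\<Union>m. ?B m) = {\<omega> \<in> space M. \<exists>m. \<not> confined W n \<delta> q m \<omega>}" by auto
  ultimately show ?thesis by simp
qed

definition clipped :: "(real \<Rightarrow> real) \<Rightarrow> real \<Rightarrow> real \<Rightarrow> real \<Rightarrow> real \<Rightarrow> real" where
  "clipped f \<epsilon> c z u = max (- c) (min c (f (\<epsilon> * u) - f (\<epsilon> * z)))"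

lemma abs_clipped_le: "c > 0 \<Longrightarrow> \<bar>clipped f \<epsilon> c z u\<bar> \<le> c"
  by (auto simp: clipped_def)

lemma clipped_eq: "\<bar>f (\<epsilon> * u) - f (\<epsilon> * z)\<bar> \<le> c \<Longrightarrow> clipped f \<epsilon> c z u = f (\<epsilon> * u) - f (\<epsilon> * z)"
  by (auto simp: clipped_def)

lemma measurable_clipped:
  assumes [measurable]: "f \<in> borel_measurable borel"
  shows "case_prod (clipped f \<epsilon> c) \<in> borel_measurable (borel \<Otimes>\<^sub>M borel)"
  unfolding clipped_def by measurable

lemma cov_increment_eq_clipped:
  fixes W :: "real \<Rightarrow> 'a \<Rightarrow> real" and \<delta> :: real and m :: nat
  defines "h \<equiv> \<delta> / 2 ^ m"
  assumes BM: "brownian_motion M W" "\<omega> \<in> space M"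
    and path_confined: "confined W n \<delta> q m \<omega>" and \<epsilon>_pos: "\<epsilon> > 0" and i_less: "i < n * 2 ^ m"
    and f_osc_le: "\<And>x y. \<bar>x - y\<bar> < \<epsilon> * q \<Longrightarrow> \<bar>f x - f y\<bar> \<le> c"
  shows "(f (\<epsilon> * W (real (Suc i) * h) \<omega>) - f (\<epsilon> * W (real i * h) \<omega>)) *
      (\<epsilon> * W (real (Suc i) * h) \<omega> - \<epsilon> * W (real i * h) \<omega>)
    = \<epsilon> * cov_term (clipped f \<epsilon> c) (i div 2 ^ m * 2 ^ m) i (increments W h \<omega>)"
proof -
  let ?W = "\<lambda>j. W (real j * h) \<omega>" and ?k = "i div 2 ^ m"
  have k_less: "?k < n" using i_less by (simp add: less_mult_imp_div_less)
  have unclipped: "clipped f \<epsilon> c (?W (?k * 2 ^ m)) (?W j) = f (\<epsilon> * ?W j) - f (\<epsilon> * ?W (?k * 2 ^ m))"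
    if j_in_block: "?k * 2 ^ m \<le> j" "j \<le> ?k * 2 ^ m + 2 ^ m" for j
  proof (intro clipped_eq f_osc_le)
    have "\<bar>?W (?k * 2 ^ m + (j - ?k * 2 ^ m)) - ?W (?k * 2 ^ m)\<bar> < q"
      using path_confined k_less j_in_block unfolding confined_def h_def
      by (simp only: le_diff_conv)
    then show "\<bar>\<epsilon> * ?W j - \<epsilon> * ?W (?k * 2 ^ m)\<bar> < \<epsilon> * q"
      using \<epsilon>_pos j_in_block(1) by (simp add: right_diff_distrib[symmetric] abs_mult)
  qed
  have "i mod 2 ^ m < 2 ^ m" by simp
  then have bounds: "?k * 2 ^ m \<le> i" "Suc i \<le> ?k * 2 ^ m + 2 ^ m"
    using div_mult_mod_eq[of i "2 ^ m"] by linarith+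
  have "clipped f \<epsilon> c (?W (?k * 2 ^ m)) (?W (Suc i)) - clipped f \<epsilon> c (?W (?k * 2 ^ m)) (?W i)
      = f (\<epsilon> * ?W (Suc i)) - f (\<epsilon> * ?W i)"
    using unclipped[OF bounds(1) Suc_leD[OF bounds(2)]]
      unclipped[OF le_SucI[OF bounds(1)] bounds(2)] by simp
  then show ?thesis
    unfolding cov_term_def walk_increments[OF BM] by (simp add: increments_def right_diff_distrib)
qed

subsection \<open>Chaining\<close>

lemma dyadic_grid_in_range:
  assumes \<delta>_pos: "\<delta> > 0" and "j \<le> n * 2 ^ m"
  shows "real j * (\<delta> / 2 ^ m) \<in> {0..real n * \<delta>}"
proof -
  have "real j \<le> real (n * 2 ^ m)" using assms(2) by (simp only: of_nat_le_iff)
  then have "real j * (\<delta> / 2 ^ m) \<le> real (n * 2 ^ m) * (\<delta> / 2 ^ m)"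
    using \<delta>_pos by (intro mult_right_mono) auto
  then show ?thesis using \<delta>_pos by simp
qed

lemma dyadic_grid_dense:
  assumes \<delta>_pos: "\<delta> > 0" and t_in: "t \<in> {0..real n * \<delta>}"
  shows "t \<in> closure {real j * (\<delta> / 2 ^ m) | j m. j \<le> n * 2 ^ m}"
  unfolding closure_approachable
proof (intro allI impI)
  fix e :: real assume "e > 0"
  obtain m where m_large: "\<delta> / e < 2 ^ m" using real_arch_pow[of 2 "\<delta> / e"] by auto
  define h where "h = \<delta> / 2 ^ m"
  have h_props: "h > 0" "h < e" "real n * \<delta> = real (n * 2 ^ m) * h"
    using m_large \<delta>_pos \<open>e > 0\<close> by (auto simp: h_def field_simps)
  define j where "j = nat \<lfloor>t / h\<rfloor>"
  have j_floor: "real j \<le> t / h" "t / h < real j + 1"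
    using t_in h_props(1) by (auto simp: j_def)
  have "t / h \<le> real (n * 2 ^ m)"
    using t_in h_props(1) unfolding h_props(3) by (simp add: pos_divide_le_eq)
  with j_floor(1) have "j \<le> n * 2 ^ m" by linarith
  moreover have "dist (real j * h) t < e"
    using j_floor h_props by (simp add: dist_real_def field_simps)
  ultimately show "\<exists>s\<in>{real j * (\<delta> / 2 ^ m) | j m. j \<le> n * 2 ^ m}. dist s t < e"
    by (auto simp: h_def)
qed

lemma SUP_abs_le_dyadic:
  fixes F :: "real \<Rightarrow> real"
  assumes \<delta>_pos: "\<delta> > 0" and cont: "continuous_on {0..real n * \<delta>} F"
    and dyadic: "\<And>j m. j \<le> n * 2 ^ m \<Longrightarrow> \<bar>F (real j * (\<delta> / 2 ^ m))\<bar> \<le> b"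
  shows "(SUP t\<in>{0..real n * \<delta>}. \<bar>F t\<bar>) \<le> b"
proof (rule cSUP_least)
  show "{0..real n * \<delta>} \<noteq> {}" using \<delta>_pos by simp
  let ?D = "{real j * (\<delta> / 2 ^ m) | j m. j \<le> n * 2 ^ m}"
  have "?D \<subseteq> {0..real n * \<delta>}" using dyadic_grid_in_range[OF \<delta>_pos] by blast
  then have "closure ?D \<subseteq> {0..real n * \<delta>}" by (rule closure_minimal) simp
  then have closure: "closure ?D = {0..real n * \<delta>}"
    using dyadic_grid_dense[OF \<delta>_pos, of _ n] by blast
  then have "continuous_on (closure ?D) (\<lambda>t. \<bar>F t\<bar>)"
    using cont by (simp only: continuous_on_rabs)
  moreover fix t assume "t \<in> {0..real n * \<delta>}"
  then have "t \<in> closure ?D" by (simp only: closure)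
  ultimately show "\<bar>F t\<bar> \<le> b"
    by (rule continuous_le_on_closure) (use dyadic in blast)
qed

lemma dyadic_chaining:
  fixes F :: "real \<Rightarrow> real"
  assumes coarse: "\<And>k. k \<le> n \<Longrightarrow> \<bar>F (real k * \<delta>)\<bar> \<le> a"
    and fine: "\<And>m j. j < n * 2 ^ Suc m \<Longrightarrow>
      \<bar>F (real (Suc j) * (\<delta> / 2 ^ Suc m)) - F (real j * (\<delta> / 2 ^ Suc m))\<bar> \<le> a * \<rho> ^ Suc m"
    and a_nonneg: "0 \<le> a" and \<rho>_nonneg: "0 \<le> \<rho>" and "j \<le> n * 2 ^ m"
  shows "\<bar>F (real j * (\<delta> / 2 ^ m))\<bar> \<le> a * (\<Sum>i\<le>m. \<rho> ^ i)"
  using assms(5)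
proof (induction m arbitrary: j)
  case 0
  then show ?case using coarse[of j] by simp
next
  case (Suc m)
  define i where "i = j div 2"
  have even_time: "real (2 * i) * (\<delta> / 2 ^ Suc m) = real i * (\<delta> / 2 ^ m)" by simp
  have "i \<le> n * 2 ^ m" using Suc.prems by (simp add: i_def)
  then have left_end: "\<bar>F (real (2 * i) * (\<delta> / 2 ^ Suc m))\<bar> \<le> a * (\<Sum>i\<le>m. \<rho> ^ i)"
    unfolding even_time by (rule Suc.IH)
  have sum_Suc: "a * (\<Sum>i\<le>Suc m. \<rho> ^ i) = a * (\<Sum>i\<le>m. \<rho> ^ i) + a * \<rho> ^ Suc m"
    by (simp add: distrib_left)
  consider (even) "j = 2 * i" | (odd) "j = Suc (2 * i)" unfolding i_def by linarith
  then show ?case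
  proof cases
    case even
    have "0 \<le> a * \<rho> ^ Suc m" using a_nonneg \<rho>_nonneg by simp
    then show ?thesis using left_end unfolding even sum_Suc by linarith
  next
    case odd
    then show ?thesis using left_end fine[of "2 * i" m] Suc.prems unfolding sum_Suc by simp
  qed
qed

text \<open>In the three estimates below, \<open>A\<close> is the exponent of the tail of the covariation over the whole
  interval.\<close>

lemma coarse_tails_sum_le:
  assumes n_ge_1: "1 \<le> n" and A_ge: "16 * real n \<le> A"
  shows "(\<Sum>k\<le>n. 2 * 2 ^ k * exp (- A)) \<le> exp (- A / 2)"
proof -
  have "(\<Sum>k\<le>n. 2 ^ k) * 2 \<le> (2::real) ^ (n + 2)"
    using sum_gp_strict[of "2::real" "Suc n"] by (simp add: lessThan_Suc_atMost)
  also have "\<dots> \<le> exp 1 ^ (n + 2)"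
    using exp_ge_add_one_self[of 1] by (intro power_mono) auto
  also have "\<dots> = exp (real n + 2)" by (subst exp_of_nat_mult[symmetric]) simp
  also have "\<dots> \<le> exp (A / 2)" using n_ge_1 A_ge by simp
  finally have "(\<Sum>k\<le>n. 2 ^ k) * 2 * exp (- A) \<le> exp (A / 2) * exp (- A)"
    by (intro mult_right_mono) auto
  also have "\<dots> = exp (- A / 2)" unfolding exp_add[symmetric] by simp
  finally show ?thesis by (simp add: sum_distrib_left mult_ac)
qed

lemma fine_exponent_ge:
  assumes n_ge_1: "1 \<le> n" and A_ge: "16 * real n \<le> A"
  shows "A / 2 + 8 * real n + 2 * real m \<le> A * real n * (9 / 8) ^ m"
proof -
  have "1 \<le> real n" using n_ge_1 by simp
  then have A_le: "16 \<le> A" "A \<le> A * real n" using A_ge mult_left_mono[of 1 "real n" A] by auto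
  have "A / 2 + 8 * real n + 2 * real m \<le> A * real n + 16 * (real m * (1 / 8))"
    using A_ge A_le by linarith
  also have "\<dots> \<le> A * real n + A * real n * (real m * (1 / 8))"
    using order_trans[OF A_le] by (intro add_left_mono mult_right_mono) auto
  also have "\<dots> = A * real n * (1 + real m * (1 / 8))" by (simp add: distrib_left)
  also have "\<dots> \<le> A * real n * (9 / 8) ^ m"
    using Bernoulli_inequality[of "1 / 8" m] A_le by (intro mult_left_mono) auto
  finally show ?thesis .
qed

lemma fine_tails_sum_le:
  assumes n_ge_1: "1 \<le> n" and A_ge: "16 * real n \<le> A"
  shows "(\<Sum>j<n * 2 ^ m. 4 * exp (- (A * real n * (9 / 8) ^ m))) \<le> exp (- A / 2) * (1 / 2) ^ m"
proof -
  have "(4::real) \<le> exp 1 * exp 1"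
    using exp_ge_add_one_self[of 1] mult_mono[of 2 "exp 1" 2 "exp 1 :: real"] by simp
  then have "(4::real) ^ Suc m \<le> exp 2 ^ Suc m"
    by (intro power_mono) (auto simp: exp_add[symmetric])
  then have four_power: "(4::real) ^ Suc m \<le> exp (2 * real (Suc m))"
    by (simp add: exp_of_nat_mult[symmetric] mult.commute del: power_Suc of_nat_Suc)
  have "real n \<le> exp (real n)" using exp_ge_add_one_self[of "real n"] by linarith
  then have "real n * 4 ^ Suc m \<le> exp (real n) * exp (2 * real (Suc m))"
    using four_power by (intro mult_mono) auto
  also have "\<dots> \<le> exp (8 * real n + 2 * real m)"
    unfolding exp_add[symmetric] using n_ge_1 by simp
  finally have "real n * 4 ^ Suc m * exp (- (A * real n * (9 / 8) ^ m))
      \<le> exp (8 * real n + 2 * real m) * exp (- (A / 2 + 8 * real n + 2 * real m))"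
    using fine_exponent_ge[OF assms, of m] by (intro mult_mono) auto
  also have "\<dots> = exp (- A / 2)" unfolding exp_add[symmetric] by simp
  finally have "real n * 4 ^ Suc m * exp (- (A * real n * (9 / 8) ^ m)) / 2 ^ m
      \<le> exp (- A / 2) / 2 ^ m"
    by (intro divide_right_mono) auto
  moreover have "(4::real) ^ Suc m = 4 * 2 ^ m * 2 ^ m" by (simp add: power_mult_distrib[symmetric])
  ultimately show ?thesis by (simp add: power_divide mult_ac)
qed

subsection \<open>Tails of the covariation process\<close>

locale brownian_qcov =
  fixes M :: "'a measure" and W :: "real \<Rightarrow> 'a \<Rightarrow> real" and f :: "real \<Rightarrow> real"
    and n :: nat and \<delta> \<epsilon> c q :: real and Q :: "real \<Rightarrow> 'a \<Rightarrow> real"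
  assumes BM: "brownian_motion M W" and n_ge_1: "1 \<le> n" and \<delta>_pos: "\<delta> > 0"
    and \<epsilon>_pos: "\<epsilon> > 0" and c_pos: "c > 0" and q_pos: "q > 0"
    and f_measurable [measurable]: "f \<in> borel_measurable borel"
    and f_osc_le: "\<And>x y. \<bar>x - y\<bar> < \<epsilon> * q \<Longrightarrow> \<bar>f x - f y\<bar> \<le> c"
    and qcov_Q: "\<And>t. t \<in> {0..real n * \<delta>} \<Longrightarrow>
        is_qcov M (\<lambda>s \<omega>. f (\<epsilon> * W s \<omega>)) (\<lambda>s \<omega>. \<epsilon> * W s \<omega>) t (Q t)"
begin

sublocale prob_space M by (rule brownian_motionD[OF BM])

abbreviation T :: real where "T \<equiv> real n * \<delta>"

definition good :: "'a set" where
  "good = {\<omega> \<in> space M. \<forall>m. confined W n \<delta> q m \<omega>}"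

lemma good_events: "good \<in> events"
proof -
  have "good = space M - (\<Union>m. {\<omega> \<in> space M. \<not> confined W n \<delta> q m \<omega>})"
    by (auto simp: good_def)
  then show ?thesis using sets_not_confined[OF BM \<delta>_pos] by auto
qed

abbreviation integrand :: "real \<Rightarrow> 'a \<Rightarrow> real" where
  "integrand \<equiv> \<lambda>s \<omega>. f (\<epsilon> * W s \<omega>)"

abbreviation integrator :: "real \<Rightarrow> 'a \<Rightarrow> real" where
  "integrator \<equiv> \<lambda>s \<omega>. \<epsilon> * W s \<omega>"

lemma path_measurable:
  assumes "u \<ge> 0"
  shows "integrand u \<in> borel_measurable M" "integrator u \<in> borel_measurable M"
  using brownian_motionD(2)[OF BM assms] by measurable

abbreviation grid_cov :: "nat \<Rightarrow> nat \<Rightarrow> 'a \<Rightarrow> real" where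
  "grid_cov m N \<equiv> cov_sum integrand integrator (\<lambda>i. real i * (\<delta> / 2 ^ m)) N"

abbreviation clipped_cov :: "nat \<Rightarrow> nat \<Rightarrow> nat \<Rightarrow> 'a \<Rightarrow> real" where
  "clipped_cov m a e \<omega> \<equiv>
    \<Sum>i=a..<e. cov_term (clipped f \<epsilon> c) (i div 2 ^ m * 2 ^ m) i (increments W (\<delta> / 2 ^ m) \<omega>)"

lemma grid_cov_diff:
  assumes "\<omega> \<in> good" "a \<le> e" "e \<le> n * 2 ^ m"
  shows "grid_cov m e \<omega> - grid_cov m a \<omega> = \<epsilon> * clipped_cov m a e \<omega>"
proof -
  have "\<omega> \<in> space M" "confined W n \<delta> q m \<omega>" using assms(1) by (auto simp: good_def)
  note cov_increment_eq_clipped[where f = f, OF BM this \<epsilon>_pos _ f_osc_le]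
  then show ?thesis
    unfolding cov_sum_diff[OF assms(2)] sum_distrib_left using assms(3)
    by (intro sum.cong refl) auto
qed

lemma grid_cov_tail:
  assumes ae_bounds: "a \<le> e" "e \<le> n * 2 ^ m" "e \<le> (a div 2 ^ m + K) * 2 ^ m"
    and r_bounds: "\<delta> / 2 ^ m * real (e - a) \<le> r" "r > 0" and g_pos: "g > 0"
  shows "prob {\<omega> \<in> good. \<bar>grid_cov m e \<omega> - grid_cov m a \<omega>\<bar> > \<epsilon> * g}
    \<le> 2 * 2 ^ K * exp (- (g\<^sup>2 / (32 * c\<^sup>2 * r)))"
proof -
  interpret G: gaussian_walk "\<delta> / 2 ^ m" by standard (use \<delta>_pos in simp)
  have "prob {\<omega> \<in> good. \<bar>grid_cov m e \<omega> - grid_cov m a \<omega>\<bar> > \<epsilon> * g}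
      \<le> prob {\<omega> \<in> space M. g \<le> \<bar>clipped_cov m a e \<omega>\<bar>}"
  proof (rule finite_measure_mono)
    show "{\<omega> \<in> good. \<bar>grid_cov m e \<omega> - grid_cov m a \<omega>\<bar> > \<epsilon> * g}
        \<subseteq> {\<omega> \<in> space M. g \<le> \<bar>clipped_cov m a e \<omega>\<bar>}"
      using \<epsilon>_pos grid_cov_diff[OF _ ae_bounds(1,2)] by (auto simp: abs_mult good_def)
    have "clipped_cov m a e \<in> borel_measurable M"
      by (intro borel_measurable_sum measurable_compose[OF G.measurable_increments[OF BM]]
          G.measurable_cov_term measurable_clipped f_measurable)
    then show "{\<omega> \<in> space M. g \<le> \<bar>clipped_cov m a e \<omega>\<bar>} \<in> events" by measurable
  qed
  also have "\<dots> \<le> 2 * 2 ^ K * exp (- (g\<^sup>2 / (32 * c\<^sup>2 * r)))"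
    by (rule G.prob_brownian_block_cov_tail[OF BM measurable_clipped[OF f_measurable]
        abs_clipped_le[OF c_pos] c_pos ae_bounds(1,3) r_bounds g_pos])
  finally show ?thesis .
qed

lemma qcov_dyadic_increment_tail:
  assumes jk_bounds: "j \<le> k" "k \<le> n * 2 ^ m" "k \<le> (j div 2 ^ m + K) * 2 ^ m"
    and qcov_U: "is_qcov M integrand integrator (real j * (\<delta> / 2 ^ m)) U"
    and qcov_V: "is_qcov M integrand integrator (real k * (\<delta> / 2 ^ m)) V"
    and r_bounds: "\<delta> / 2 ^ m * real (k - j) \<le> r" "r > 0" and g_pos: "g > 0"
  shows "prob {\<omega> \<in> good. \<bar>V \<omega> - U \<omega>\<bar> > \<epsilon> * g} \<le> 2 * 2 ^ K * exp (- (g\<^sup>2 / (128 * c\<^sup>2 * r)))"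
proof (rule qcov_increment_tail[OF path_measurable _ qcov_U qcov_V _ good_events])
  show "\<delta> / 2 ^ m > 0" "\<epsilon> * g > 0" using \<delta>_pos \<epsilon>_pos g_pos by auto
  fix s :: nat
  have refine: "i \<le> (d * 2 ^ m) \<Longrightarrow> i * 2 ^ s \<le> d * 2 ^ (m + s)" for i d :: nat
    using mult_le_mono1[of i "d * 2 ^ m" "2 ^ s"] by (simp add: power_add mult.assoc)
  have "j * 2 ^ s div 2 ^ (m + s) = j div 2 ^ m"
    by (simp add: power_add)
  moreover have "\<delta> / 2 ^ (m + s) * real (k * 2 ^ s - j * 2 ^ s) = \<delta> / 2 ^ m * real (k - j)"
    by (simp add: power_add diff_mult_distrib[symmetric])
  ultimately have "prob {\<omega> \<in> good.
        \<bar>grid_cov (m + s) (k * 2 ^ s) \<omega> - grid_cov (m + s) (j * 2 ^ s) \<omega>\<bar> > \<epsilon> * (g / 2)}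
      \<le> 2 * 2 ^ K * exp (- ((g / 2)\<^sup>2 / (32 * c\<^sup>2 * r)))"
    using jk_bounds r_bounds g_pos by (intro grid_cov_tail refine) (auto intro: refine)
  then show "prob {\<omega> \<in> good.
        \<bar>cov_sum integrand integrator (\<lambda>i. real i * (\<delta> / 2 ^ m / 2 ^ s)) (k * 2 ^ s) \<omega>
          - cov_sum integrand integrator (\<lambda>i. real i * (\<delta> / 2 ^ m / 2 ^ s)) (j * 2 ^ s) \<omega>\<bar>
        > \<epsilon> * g / 2}
      \<le> 2 * 2 ^ K * exp (- (g\<^sup>2 / (128 * c\<^sup>2 * r)))"
    by (simp add: power_add power_divide mult.assoc)
qed

lemma coarse_tail:
  assumes k_le: "k \<le> n" and g_pos: "g > 0"
  shows "prob {\<omega> \<in> good. \<bar>Q (real k * \<delta>) \<omega>\<bar> > \<epsilon> * g} \<le> 2 * 2 ^ k * exp (- (g\<^sup>2 / (128 * c\<^sup>2 * T)))"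
proof -
  have "\<delta> * real k \<le> T" using k_le \<delta>_pos by (simp add: mult.commute)
  then have "prob {\<omega> \<in> good. \<bar>Q (real k * \<delta>) \<omega> - 0\<bar> > \<epsilon> * g}
      \<le> 2 * 2 ^ k * exp (- (g\<^sup>2 / (128 * c\<^sup>2 * T)))"
    using k_le g_pos n_ge_1 \<delta>_pos qcov_Q[of "real k * \<delta>"] is_qcov_0
    by (intro qcov_dyadic_increment_tail[where j = 0 and m = 0 and k = k]) (auto simp: mult.commute)
  then show ?thesis by simp
qed

lemma fine_tail:
  assumes j_less: "j < n * 2 ^ m" and g_pos: "g > 0"
  shows "prob {\<omega> \<in> good. \<bar>Q (real (Suc j) * (\<delta> / 2 ^ m)) \<omega> - Q (real j * (\<delta> / 2 ^ m)) \<omega>\<bar> > \<epsilon> * g}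
    \<le> 4 * exp (- (g\<^sup>2 / (128 * c\<^sup>2 * (\<delta> / 2 ^ m))))"
proof -
  have "j mod 2 ^ m < 2 ^ m" by simp
  then have "Suc j \<le> (j div 2 ^ m + 1) * 2 ^ m"
    using div_mult_mod_eq[of j "2 ^ m"] unfolding add_mult_distrib by linarith
  then have "prob {\<omega> \<in> good.
        \<bar>Q (real (Suc j) * (\<delta> / 2 ^ m)) \<omega> - Q (real j * (\<delta> / 2 ^ m)) \<omega>\<bar> > \<epsilon> * g}
      \<le> 2 * 2 ^ 1 * exp (- (g\<^sup>2 / (128 * c\<^sup>2 * (\<delta> / 2 ^ m))))"
    using j_less g_pos \<delta>_pos
    by (intro qcov_dyadic_increment_tail[
          OF _ _ _ qcov_Q[OF dyadic_grid_in_range[OF \<delta>_pos]] qcov_Q[OF dyadic_grid_in_range[OF \<delta>_pos]]]) auto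
  then show ?thesis by simp
qed

text \<open>The thresholds decrease by the factor \<open>3/4\<close> from level to level: they are summable, yet shrink
  more slowly than the standard deviation \<open>2\<^bsup>- m/2\<^esup>\<close> of the increments.\<close>

definition coarse_excess :: "real \<Rightarrow> nat \<Rightarrow> 'a set" where
  "coarse_excess g k = {\<omega> \<in> good. \<bar>Q (real k * \<delta>) \<omega>\<bar> > \<epsilon> * (g / 4)}"

definition fine_excess :: "real \<Rightarrow> nat \<Rightarrow> nat \<Rightarrow> 'a set" where
  "fine_excess g m j = {\<omega> \<in> good.
    \<bar>Q (real (Suc j) * (\<delta> / 2 ^ m)) \<omega> - Q (real j * (\<delta> / 2 ^ m)) \<omega>\<bar> > \<epsilon> * (g / 4 * (3 / 4) ^ m)}"

primrec excess :: "real \<Rightarrow> nat \<Rightarrow> 'a set" where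
  "excess g 0 = (\<Union>k\<le>n. coarse_excess g k)"
| "excess g (Suc m) = (\<Union>j<n * 2 ^ Suc m. fine_excess g (Suc m) j)"

lemma coarse_excess_events:
  assumes "k \<le> n"
  shows "coarse_excess g k \<in> events"
proof -
  have [measurable]: "Q (real k * \<delta>) \<in> borel_measurable M"
    using is_qcov_measurable[OF qcov_Q[OF dyadic_grid_in_range[OF \<delta>_pos, of k n 0]]] assms by simp
  have "coarse_excess g k = good \<inter> {\<omega> \<in> space M. \<bar>Q (real k * \<delta>) \<omega>\<bar> > \<epsilon> * (g / 4)}"
    by (auto simp: coarse_excess_def good_def)
  then show ?thesis using good_events by simp
qed

lemma fine_excess_events:
  assumes "j < n * 2 ^ m"
  shows "fine_excess g m j \<in> events"
proof -
  have [measurable]: "Q (real (Suc j) * (\<delta> / 2 ^ m)) \<in> borel_measurable M"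
      "Q (real j * (\<delta> / 2 ^ m)) \<in> borel_measurable M"
    using assms by (intro is_qcov_measurable[OF qcov_Q] dyadic_grid_in_range[OF \<delta>_pos]; simp)+
  have "fine_excess g m j = good \<inter> {\<omega> \<in> space M.
      \<bar>Q (real (Suc j) * (\<delta> / 2 ^ m)) \<omega> - Q (real j * (\<delta> / 2 ^ m)) \<omega>\<bar> > \<epsilon> * (g / 4 * (3 / 4) ^ m)}"
    by (auto simp: fine_excess_def good_def)
  also have "\<dots> \<in> events" by (intro sets.Int good_events) measurable
  finally show ?thesis .
qed

lemma excess_events: "excess g m \<in> events"
  by (cases m) (auto intro!: sets.finite_UN coarse_excess_events fine_excess_events
      simp del: power_Suc)

lemma excess_tail:
  assumes g_pos: "g > 0" and A_props: "g\<^sup>2 = 2048 * T * c\<^sup>2 * A" "16 * real n \<le> A"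
  shows "prob (excess g m) \<le> exp (- A / 2) * (1 / 2) ^ m"
proof (cases m)
  case 0
  have "(g / 4)\<^sup>2 / (128 * c\<^sup>2 * T) = A"
    using A_props(1) n_ge_1 \<delta>_pos c_pos by (simp add: power_divide field_simps)
  then have single_tail: "prob (coarse_excess g k) \<le> 2 * 2 ^ k * exp (- A)" if "k \<le> n" for k
    unfolding coarse_excess_def using coarse_tail[OF that, of "g / 4"] g_pos by simp
  have "prob (excess g m) \<le> (\<Sum>k\<le>n. prob (coarse_excess g k))"
    unfolding 0 excess.simps by (intro measure_UNION_le) (auto intro: coarse_excess_events)
  also have "\<dots> \<le> (\<Sum>k\<le>n. 2 * 2 ^ k * exp (- A))"
    by (intro sum_mono single_tail) simp
  also have "\<dots> \<le> exp (- A / 2)" by (rule coarse_tails_sum_le[OF n_ge_1 A_props(2)])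
  finally show ?thesis by (simp add: 0)
next
  case (Suc m')
  have "(g / 4 * z)\<^sup>2 / (128 * c\<^sup>2 * (\<delta> / 2 ^ m)) = g\<^sup>2 / (2048 * c\<^sup>2 * \<delta>) * (z\<^sup>2 * 2 ^ m)" for z
    by (simp add: power_mult_distrib power_divide)
  also have "((3 / 4 :: real) ^ m)\<^sup>2 * 2 ^ m = (9 / 8) ^ m"
    by (simp add: power2_eq_square power_mult_distrib[symmetric])
  also have "g\<^sup>2 / (2048 * c\<^sup>2 * \<delta>) = A * real n"
    using A_props(1) \<delta>_pos c_pos by (simp add: field_simps)
  finally have exponent: "(g / 4 * (3 / 4) ^ m)\<^sup>2 / (128 * c\<^sup>2 * (\<delta> / 2 ^ m))
      = A * real n * (9 / 8) ^ m" .
  have single_tail: "prob (fine_excess g m j) \<le> 4 * exp (- (A * real n * (9 / 8) ^ m))"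
    if "j < n * 2 ^ m" for j
    unfolding fine_excess_def exponent[symmetric] using g_pos by (intro fine_tail that) simp
  have "prob (excess g m) \<le> (\<Sum>j<n * 2 ^ m. prob (fine_excess g m j))"
    unfolding Suc excess.simps by (intro measure_UNION_le) (auto intro: fine_excess_events)
  also have "\<dots> \<le> (\<Sum>j<n * 2 ^ m. 4 * exp (- (A * real n * (9 / 8) ^ m)))"
    by (intro sum_mono single_tail) simp
  also have "\<dots> \<le> exp (- A / 2) * (1 / 2) ^ m" by (rule fine_tails_sum_le[OF n_ge_1 A_props(2)])
  finally show ?thesis .
qed

lemma SUP_le_if_no_excess:
  assumes cont: "continuous_on {0..T} (\<lambda>t. Q t \<omega>)" and g_pos: "g > 0"
    and no_excess: "\<omega> \<in> good" "\<And>m. \<omega> \<notin> excess g m"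
  shows "(SUP t\<in>{0..T}. \<bar>Q t \<omega>\<bar>) / \<epsilon> \<le> g"
proof -
  have coarse: "\<bar>Q (real k * \<delta>) \<omega>\<bar> \<le> \<epsilon> * (g / 4)" if "k \<le> n" for k
    using no_excess(1) no_excess(2)[of 0] that by (auto simp: coarse_excess_def not_less)
  have fine: "\<bar>Q (real (Suc j) * (\<delta> / 2 ^ Suc m)) \<omega> - Q (real j * (\<delta> / 2 ^ Suc m)) \<omega>\<bar>
      \<le> \<epsilon> * (g / 4) * (3 / 4) ^ Suc m" if "j < n * 2 ^ Suc m" for j m
  proof -
    have "\<omega> \<notin> fine_excess g (Suc m) j" using no_excess(2)[of "Suc m"] that by auto
    then show ?thesis
      using no_excess(1)
      by (simp only: fine_excess_def mem_Collect_eq not_less simp_thms mult.assoc)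
  qed
  have "(SUP t\<in>{0..T}. \<bar>Q t \<omega>\<bar>) \<le> \<epsilon> * g"
  proof (rule SUP_abs_le_dyadic[OF \<delta>_pos cont])
    fix j m assume j_le: "j \<le> n * 2 ^ m"
    have "\<bar>Q (real j * (\<delta> / 2 ^ m)) \<omega>\<bar> \<le> \<epsilon> * (g / 4) * (\<Sum>i\<le>m. (3 / 4) ^ i)"
      by (rule dyadic_chaining[OF coarse fine _ _ j_le]) (use \<epsilon>_pos g_pos in auto)
    also have "(\<Sum>i\<le>m. (3 / 4 :: real) ^ i) \<le> 4"
      using sum_gp_strict[of "3 / 4 :: real" "Suc m"] by (simp add: lessThan_Suc_atMost)
    finally show "\<bar>Q (real j * (\<delta> / 2 ^ m)) \<omega>\<bar> \<le> \<epsilon> * g"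
      using \<epsilon>_pos g_pos by (simp add: mult_left_mono)
  qed
  then show ?thesis using \<epsilon>_pos by (simp add: field_simps)
qed

lemma SUP_tail:
  assumes cont: "\<And>\<omega>. \<omega> \<in> space M \<Longrightarrow> continuous_on {0..T} (\<lambda>t. Q t \<omega>)"
    and g_pos: "g > 0" and A_props: "g\<^sup>2 = 2048 * T * c\<^sup>2 * A" "16 * real n \<le> A"
  shows "prob {\<omega> \<in> space M. (SUP t\<in>{0..T}. \<bar>Q t \<omega>\<bar>) / \<epsilon> > g}
    \<le> 2 * exp (- A / 2) + real n * (2 * exp (- (q\<^sup>2 / (2 * \<delta>))))"
proof -
  have geometric: "(\<lambda>m. exp (- A / 2) * (1 / 2) ^ m) sums (exp (- A / 2) * 2)"
    using geometric_sums[of "1 / 2 :: real"] by (intro sums_mult) simp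
  have probs_summable: "summable (\<lambda>m. prob (excess g m))"
    by (rule summable_comparison_test'[OF sums_summable[OF geometric], of 0])
       (use excess_tail[OF g_pos A_props] in auto)
  have "prob (\<Union>m. excess g m) \<le> (\<Sum>m. prob (excess g m))"
    using excess_events by (intro finite_measure_subadditive_countably probs_summable) auto
  also have "\<dots> \<le> (\<Sum>m. exp (- A / 2) * (1 / 2) ^ m)"
    by (intro suminf_le excess_tail[OF g_pos A_props] probs_summable sums_summable[OF geometric])
  also have "\<dots> = 2 * exp (- A / 2)" using sums_unique[OF geometric] by simp
  finally have excess_prob: "prob (\<Union>m. excess g m) \<le> 2 * exp (- A / 2)" .
  have not_good: "{\<omega> \<in> space M. \<exists>m. \<not> confined W n \<delta> q m \<omega>} = space M - good"
    by (auto simp: good_def)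
  have "{\<omega> \<in> space M. (SUP t\<in>{0..T}. \<bar>Q t \<omega>\<bar>) / \<epsilon> > g} \<subseteq> (\<Union>m. excess g m) \<union> (space M - good)"
    using SUP_le_if_no_excess[OF cont g_pos] by (fastforce simp: not_le[symmetric])
  then have "prob {\<omega> \<in> space M. (SUP t\<in>{0..T}. \<bar>Q t \<omega>\<bar>) / \<epsilon> > g}
      \<le> prob ((\<Union>m. excess g m) \<union> (space M - good))"
    using excess_events good_events by (intro finite_measure_mono) auto
  also have "\<dots> \<le> prob (\<Union>m. excess g m) + prob (space M - good)"
    using excess_events good_events by (intro measure_Un_le) auto
  also have "\<dots> \<le> 2 * exp (- A / 2) + real n * (2 * exp (- (q\<^sup>2 / (2 * \<delta>))))"
    using excess_prob prob_ex_not_confined_le[OF BM \<delta>_pos q_pos, of n] unfolding not_good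
    by (rule add_mono)
  finally show ?thesis .
qed

end

subsection \<open>Moduli of oscillation\<close>

lemma abs_diff_le_osc:
  assumes "bounded (range f)" "\<bar>x - y\<bar> < d"
  shows "\<bar>f x - f y\<bar> \<le> osc f d"
proof -
  obtain B where f_bound: "\<And>x. \<bar>f x\<bar> \<le> B"
    using assms(1) unfolding bounded_iff by auto
  have "bdd_above ((\<lambda>p. \<bar>f (fst p) - f (snd p)\<bar>) ` {(s, t). \<bar>t - s\<bar> < d})"
  proof (rule bdd_aboveI2)
    fix p :: "real \<times> real"
    show "\<bar>f (fst p) - f (snd p)\<bar> \<le> 2 * B"
      using f_bound[of "fst p"] f_bound[of "snd p"] by linarith
  qed
  then show ?thesis
    using cSUP_upper[of "(x, y)" "{(s, t). \<bar>t - s\<bar> < d}" "\<lambda>p. \<bar>f (fst p) - f (snd p)\<bar>"] assms(2)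
    unfolding osc_def by (simp add: abs_minus_commute)
qed

lemma osc_nonneg: "bounded (range f) \<Longrightarrow> d > 0 \<Longrightarrow> 0 \<le> osc f d"
  using abs_diff_le_osc[of f 0 0 d] by simp

lemma continuous_on_if_hoelder_osc:
  assumes f_bdd: "bounded (range f)" and \<alpha>_pos: "0 < \<alpha>"
    and hoelder: "\<exists>\<delta>0>0. \<forall>\<delta>. 0 < \<delta> \<and> \<delta> < \<delta>0 \<longrightarrow> osc f \<delta> \<le> C * \<delta> powr \<alpha>"
  shows "continuous_on UNIV f"
  unfolding continuous_on_iff
proof (intro ballI allI impI)
  fix x e :: real assume "e > 0"
  have "((\<lambda>\<delta>. C * \<delta> powr \<alpha>) \<longlongrightarrow> 0) (at_right 0)"
    using \<alpha>_pos by real_asymp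
  then have small: "eventually (\<lambda>\<delta>. C * \<delta> powr \<alpha> < e) (at_right 0)"
    using \<open>e > 0\<close> by (rule order_tendstoD)
  have osc_le: "eventually (\<lambda>\<delta>. 0 < \<delta> \<and> osc f \<delta> \<le> C * \<delta> powr \<alpha>) (at_right 0)"
    using hoelder unfolding eventually_at_right_field by auto
  obtain d where d_small: "0 < d" "osc f d < e"
    using eventually_happens[OF eventually_conj[OF small osc_le]] by auto
  have "dist (f y) (f x) < e" if "dist y x < d" for y
    using abs_diff_le_osc[OF f_bdd, of y x d] d_small(2) that by (simp add: dist_real_def)
  with d_small(1) show "\<exists>d>0. \<forall>y\<in>UNIV. dist y x < d \<longrightarrow> dist (f y) (f x) < e" by blast
qed

text \<open>The two alternatives of the proof reflect \<open>gauss_tail K g 0 = 0\<close>: if \<open>f\<close> does not oscillate at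
  scale \<open>\<epsilon> q\<close>, then every clipping height \<open>c > 0\<close> is allowed, and \<open>A\<close> can be sent to infinity.\<close>

lemma qcov_SUP_tail_gauss_tail:
  fixes T :: real
  assumes BM: "brownian_motion M W" and n_ge_1: "1 \<le> n" and T_pos: "T > 0" and \<epsilon>_pos: "\<epsilon> > 0"
    and q_pos: "q > 0"
    and f_props: "bounded (range f)" "f \<in> borel_measurable borel"
    and qcov_Q: "\<And>t. t \<in> {0..T} \<Longrightarrow> is_qcov M (\<lambda>s \<omega>. f (\<epsilon> * W s \<omega>)) (\<lambda>s \<omega>. \<epsilon> * W s \<omega>) t (Q t)"
    and cont: "\<And>\<omega>. \<omega> \<in> space M \<Longrightarrow> continuous_on {0..T} (\<lambda>t. Q t \<omega>)"
    and g_pos: "g > 0" and small: "32768 * T * real n * (osc f (\<epsilon> * q))\<^sup>2 \<le> g\<^sup>2"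
  shows "measure M {\<omega> \<in> space M. (SUP t\<in>{0..T}. \<bar>Q t \<omega>\<bar>) / \<epsilon> > g}
    \<le> 2 * gauss_tail (1 / (4096 * T)) g (osc f (\<epsilon> * q)) +
      real n * (2 * exp (- (q\<^sup>2 / (2 * (T / real n)))))"
    (is "?P \<le> _ + ?R")
proof -
  define w where "w = osc f (\<epsilon> * q)"
  have w_nonneg: "0 \<le> w" unfolding w_def using \<epsilon>_pos q_pos by (intro osc_nonneg[OF f_props(1)]) simp
  have bound: "?P \<le> 2 * exp (- A / 2) + ?R"
    if A_bounds: "16 * real n \<le> A" "2048 * T * w\<^sup>2 * A \<le> g\<^sup>2" for A
  proof -
    define c where "c = g / sqrt (2048 * T * A)"
    have "A > 0" using A_bounds(1) n_ge_1 by simp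
    then have c_props: "c > 0" "g\<^sup>2 = 2048 * T * c\<^sup>2 * A"
      using T_pos g_pos by (simp_all add: c_def power_divide)
    then have "w\<^sup>2 \<le> c\<^sup>2" using A_bounds(2) \<open>A > 0\<close> T_pos by simp
    then have "w \<le> c" by (rule power2_le_imp_le) (use c_props(1) in simp)
    interpret B: brownian_qcov M W f n "T / real n" \<epsilon> c q Q
    proof
      show "\<bar>f x - f y\<bar> \<le> c" if "\<bar>x - y\<bar> < \<epsilon> * q" for x y
        using abs_diff_le_osc[OF f_props(1) that] \<open>w \<le> c\<close> by (simp add: w_def)
    qed (use BM n_ge_1 T_pos \<epsilon>_pos c_props(1) q_pos f_props qcov_Q in auto)
    have "real n * (T / real n) = T" using n_ge_1 by simp
    then show ?thesis using B.SUP_tail[of g A] cont g_pos c_props(2) A_bounds(1) by simp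
  qed
  show ?thesis
  proof (cases "w = 0")
    case True
    have "((\<lambda>A. 2 * exp (- A / 2) + ?R) \<longlongrightarrow> 0 + ?R) at_top"
      by (intro tendsto_add tendsto_const) real_asymp
    moreover have "eventually (\<lambda>A. ?P \<le> 2 * exp (- A / 2) + ?R) at_top"
      using eventually_ge_at_top[of "16 * real n"] by eventually_elim (use bound True in auto)
    ultimately have "?P \<le> 0 + ?R" by (rule tendsto_lowerbound) simp
    then show ?thesis using True by (simp add: gauss_tail_def w_def)
  next
    case False
    define A where "A = g\<^sup>2 / (2048 * T * w\<^sup>2)"
    have "16 * real n \<le> A" "2048 * T * w\<^sup>2 * A \<le> g\<^sup>2"
      using small False T_pos by (simp_all add: A_def w_def[symmetric] field_simps)
    from bound[OF this] show ?thesis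
      using False by (simp add: gauss_tail_def A_def w_def[symmetric] mult.assoc)
  qed
qed

lemma exp_confinement_exponent:
  fixes \<delta> :: real
  assumes "0 < \<delta>" "\<delta> < 1"
  shows "exp (- ((2 * sqrt (\<delta> * \<bar>ln \<delta>\<bar>))\<^sup>2 / (2 * \<delta>))) = \<delta>\<^sup>2"
proof -
  have square: "(2 * sqrt (\<delta> * \<bar>ln \<delta>\<bar>))\<^sup>2 = 4 * (\<delta> * \<bar>ln \<delta>\<bar>)"
    using assms(1) by (simp add: power_mult_distrib)
  have exponent: "- ((2 * sqrt (\<delta> * \<bar>ln \<delta>\<bar>))\<^sup>2 / (2 * \<delta>)) = ln \<delta> + ln \<delta>"
    unfolding square using assms by simp
  show ?thesis unfolding exponent exp_add using assms by (simp add: power2_eq_square)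
qed

lemma oscillation_le_if_ratio_le:
  fixes \<delta> w g \<kappa> :: real
  assumes \<delta>_bounds: "0 < \<delta>" "\<delta> \<le> exp (- 1)" and w_nonneg: "0 \<le> w" and g_pos: "g > 0"
    and ratio: "\<bar>ln \<delta>\<bar> * w / (2 * sqrt (\<delta> * \<bar>ln \<delta>\<bar>) * g) \<le> \<kappa>"
  shows "w\<^sup>2 \<le> 4 * \<kappa>\<^sup>2 * \<delta> * g\<^sup>2"
proof -
  define L where "L = \<bar>ln \<delta>\<bar>"
  have "ln \<delta> \<le> - 1" using ln_le_cancel_iff[of \<delta> "exp (- 1)"] \<delta>_bounds by simp
  then have L_ge_1: "1 \<le> L" by (simp add: L_def)
  have "L * w \<le> \<kappa> * (2 * sqrt (\<delta> * L) * g)"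
    using ratio \<delta>_bounds g_pos L_ge_1 by (simp add: L_def[symmetric] pos_divide_le_eq)
  then have "(L * w)\<^sup>2 \<le> (\<kappa> * (2 * sqrt (\<delta> * L) * g))\<^sup>2"
    using L_ge_1 w_nonneg by (intro power_mono) auto
  then have "L * (L * w\<^sup>2) \<le> L * (4 * \<kappa>\<^sup>2 * \<delta> * g\<^sup>2)"
    using \<delta>_bounds L_ge_1 by (simp add: power_mult_distrib power2_eq_square mult_ac)
  then have "L * w\<^sup>2 \<le> 4 * \<kappa>\<^sup>2 * \<delta> * g\<^sup>2" using L_ge_1 by simp
  moreover have "1 * w\<^sup>2 \<le> L * w\<^sup>2" using L_ge_1 by (intro mult_right_mono) auto
  ultimately show ?thesis by simp
qed

lemma qcov_SUP_tail:
  fixes T :: real and n :: nat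
  defines "\<delta> \<equiv> T / real n"
  defines "q \<equiv> 2 * sqrt (\<delta> * \<bar>ln \<delta>\<bar>)"
  assumes BM: "brownian_motion M W" and T_pos: "T > 0" and \<epsilon>_pos: "\<epsilon> > 0"
    and f_props: "bounded (range f)" "f \<in> borel_measurable borel"
    and qcov_Q: "\<And>t. t \<in> {0..T} \<Longrightarrow> is_qcov M (\<lambda>s \<omega>. f (\<epsilon> * W s \<omega>)) (\<lambda>s \<omega>. \<epsilon> * W s \<omega>) t (Q t)"
    and cont: "\<And>\<omega>. \<omega> \<in> space M \<Longrightarrow> continuous_on {0..T} (\<lambda>t. Q t \<omega>)"
    and n_ge_1: "1 \<le> n" and \<delta>_small: "\<delta> < exp (- 1)" and g_bounds: "0 < g" "g < 1"
    and ratio: "\<bar>ln \<delta>\<bar> * osc f (\<epsilon> * q) / (q * g) < 1 / (512 * T)"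
  shows "measure M {\<omega> \<in> space M. (SUP t\<in>{0..T}. \<bar>Q t \<omega>\<bar>) / \<epsilon> > g}
    \<le> 2 / g * gauss_tail (1 / (4096 * T)) g (osc f (\<epsilon> * q)) + 2 * T * \<delta>"
proof -
  let ?w = "osc f (\<epsilon> * q)"
  have \<delta>_pos: "0 < \<delta>" using T_pos n_ge_1 by (simp add: \<delta>_def)
  have \<delta>_less_1: "\<delta> < 1" using \<delta>_small by (rule less_trans) simp
  have "ln \<delta> \<noteq> 0" using \<delta>_pos \<delta>_less_1 by simp
  then have q_pos: "q > 0"
    unfolding q_def using \<delta>_pos by (intro mult_pos_pos real_sqrt_gt_zero) simp_all
  have "?w\<^sup>2 \<le> 4 * (1 / (512 * T))\<^sup>2 * \<delta> * g\<^sup>2"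
    using ratio \<delta>_small \<epsilon>_pos q_pos unfolding q_def
    by (intro oscillation_le_if_ratio_le[OF \<delta>_pos _ _ g_bounds(1)] osc_nonneg[OF f_props(1)]) auto
  then have "32768 * T * real n * ?w\<^sup>2 \<le> 32768 * T * real n * (4 * (1 / (512 * T))\<^sup>2 * \<delta> * g\<^sup>2)"
    using T_pos by (intro mult_left_mono) auto
  also have "\<dots> = g\<^sup>2 / 2" using T_pos n_ge_1 by (simp add: \<delta>_def power2_eq_square)
  also have "\<dots> \<le> g\<^sup>2" by simp
  finally have small: "32768 * T * real n * ?w\<^sup>2 \<le> g\<^sup>2" .
  have "measure M {\<omega> \<in> space M. (SUP t\<in>{0..T}. \<bar>Q t \<omega>\<bar>) / \<epsilon> > g}
      \<le> 2 * gauss_tail (1 / (4096 * T)) g ?w + real n * (2 * exp (- (q\<^sup>2 / (2 * \<delta>))))"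
    unfolding \<delta>_def
    by (rule qcov_SUP_tail_gauss_tail[
          OF BM n_ge_1 T_pos \<epsilon>_pos q_pos f_props qcov_Q cont g_bounds(1) small])
  also have "real n * (2 * exp (- (q\<^sup>2 / (2 * \<delta>)))) = 2 * T * \<delta>"
    unfolding q_def exp_confinement_exponent[OF \<delta>_pos \<delta>_less_1] using n_ge_1
    by (simp add: \<delta>_def power2_eq_square)
  also have "2 * gauss_tail (1 / (4096 * T)) g ?w \<le> 2 / g * gauss_tail (1 / (4096 * T)) g ?w"
    using g_bounds by (intro mult_right_mono) (auto simp: gauss_tail_def field_simps)
  finally show ?thesis by simp
qed

theorem theorem4:
  fixes M :: "'a measure" and W :: "real \<Rightarrow> 'a \<Rightarrow> real"
    and f :: "real \<Rightarrow> real" and T \<alpha> C :: real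
    and Q :: "real \<Rightarrow> real \<Rightarrow> 'a \<Rightarrow> real"
    and n :: "real \<Rightarrow> nat" and \<gamma> :: "real \<Rightarrow> real"
  assumes BM: "brownian_motion M W"
    and T: "T > 0"
    and f_bdd: "bounded (range f)"
    and \<alpha>: "0 < \<alpha>" "\<alpha> \<le> 1" and C: "C > 0"
    and osc_hoelder: "\<exists>\<delta>0>0. \<forall>\<delta>. 0 < \<delta> \<and> \<delta> < \<delta>0 \<longrightarrow> osc f \<delta> \<le> C * \<delta> powr \<alpha>"
    and Q_qcov: "\<And>\<epsilon> t. \<epsilon> > 0 \<Longrightarrow> t \<in> {0..T} \<Longrightarrow>
        is_qcov M (\<lambda>s \<omega>. f (\<epsilon> * W s \<omega>)) (\<lambda>s \<omega>. \<epsilon> * W s \<omega>) t (Q \<epsilon> t)"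
    and Q_cont: "\<And>\<epsilon> \<omega>. \<epsilon> > 0 \<Longrightarrow> \<omega> \<in> space M \<Longrightarrow> continuous_on {0..T} (\<lambda>t. Q \<epsilon> t \<omega>)"
    and n_pos: "\<And>\<epsilon>. \<epsilon> > 0 \<Longrightarrow> n \<epsilon> > 0"
    and n_mono: "\<And>\<epsilon>1 \<epsilon>2. 0 < \<epsilon>1 \<Longrightarrow> \<epsilon>1 \<le> \<epsilon>2 \<Longrightarrow> n \<epsilon>2 \<le> n \<epsilon>1"
    and n_lim: "filterlim n at_top (at_right 0)"
    and \<gamma>_pos: "\<And>\<epsilon>. \<epsilon> > 0 \<Longrightarrow> \<gamma> \<epsilon> > 0"
    and \<gamma>_lim: "(\<gamma> \<longlongrightarrow> 0) (at_right 0)"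
    and cond: "((\<lambda>\<epsilon>. let \<delta> = T / real (n \<epsilon>); q = 2 * sqrt (\<delta> * \<bar>ln \<delta>\<bar>) in
                 \<bar>ln \<delta>\<bar> * osc f (\<epsilon> * q) / (q * \<gamma> \<epsilon>)) \<longlongrightarrow> 0) (at_right 0)"
  shows "\<exists>K1 K2 K3 \<epsilon>0. K1 > 0 \<and> K2 > 0 \<and> K3 > 0 \<and> \<epsilon>0 > 0 \<and>
    (\<forall>\<epsilon>. 0 < \<epsilon> \<and> \<epsilon> < \<epsilon>0 \<longrightarrow>
      (let \<delta> = T / real (n \<epsilon>); q = 2 * sqrt (\<delta> * \<bar>ln \<delta>\<bar>) in
        measure M {\<omega> \<in> space M. (SUP t\<in>{0..T}. \<bar>Q \<epsilon> t \<omega>\<bar>) / \<epsilon> > \<gamma> \<epsilon>}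
          \<le> K1 / \<gamma> \<epsilon> * gauss_tail K3 (\<gamma> \<epsilon>) (osc f (\<epsilon> * q)) + K2 * \<delta>))"
proof -
  let ?\<delta> = "\<lambda>\<epsilon>. T / real (n \<epsilon>)"
  let ?q = "\<lambda>\<epsilon>. 2 * sqrt (?\<delta> \<epsilon> * \<bar>ln (?\<delta> \<epsilon>)\<bar>)"
  let ?bound = "\<lambda>\<epsilon>. measure M {\<omega> \<in> space M. (SUP t\<in>{0..T}. \<bar>Q \<epsilon> t \<omega>\<bar>) / \<epsilon> > \<gamma> \<epsilon>}
      \<le> 2 / \<gamma> \<epsilon> * gauss_tail (1 / (4096 * T)) (\<gamma> \<epsilon>) (osc f (\<epsilon> * ?q \<epsilon>)) + 2 * T * ?\<delta> \<epsilon>"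
  have f_measurable: "f \<in> borel_measurable borel"
    by (intro borel_measurable_continuous_onI
        continuous_on_if_hoelder_osc[OF f_bdd \<alpha>(1) osc_hoelder])
  have "(?\<delta> \<longlongrightarrow> 0) (at_right 0)"
    by (intro real_tendsto_divide_at_top[OF tendsto_const]
        filterlim_compose[OF filterlim_real_sequentially n_lim])
  then have "eventually (\<lambda>\<epsilon>. ?\<delta> \<epsilon> < exp (- 1)) (at_right 0)" by (rule order_tendstoD) simp
  moreover have "eventually (\<lambda>\<epsilon>. \<gamma> \<epsilon> < 1) (at_right 0)" by (rule order_tendstoD[OF \<gamma>_lim]) simp
  moreover have "eventually (\<lambda>\<epsilon>. \<bar>ln (?\<delta> \<epsilon>)\<bar> * osc f (\<epsilon> * ?q \<epsilon>) / (?q \<epsilon> * \<gamma> \<epsilon>)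
      < 1 / (512 * T)) (at_right 0)"
    using T by (intro order_tendstoD(2)[OF cond[unfolded Let_def]]) simp
  ultimately have "eventually ?bound (at_right 0)"
    using eventually_at_right_less[of 0]
  proof eventually_elim
    case (elim \<epsilon>)
    then have "1 \<le> n \<epsilon>" using n_pos[of \<epsilon>] by simp
    with elim show ?case by (intro qcov_SUP_tail[OF BM T _ f_bdd f_measurable Q_qcov Q_cont] \<gamma>_pos)
  qed
  then obtain \<epsilon>0 where "\<epsilon>0 > 0" "\<And>\<epsilon>. 0 < \<epsilon> \<Longrightarrow> \<epsilon> < \<epsilon>0 \<Longrightarrow> ?bound \<epsilon>"
    unfolding eventually_at_right_field by auto
  with T show ?thesis
    unfolding Let_def
    by (intro exI[of _ 2] exI[of _ "2 * T"] exI[of _ "1 / (4096 * T)"] exI[of _ \<epsilon>0]) auto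
qed

end
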